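(* Let $d<0$ be a square-free integer with $d\equiv5\pmod 8$, let $O_d$ be the ring of integers of $\mathbb Q(\sqrt d)$, and let $B_d=PSL(2,O_d)$. Then each of the two subgroups $B_d'$ and $B_d^2$ of $B_d$ is non-congruence if and only if $d\neq-3$.
   Context: $B_d'=[B_d,B_d]$ is the commutator subgroup and $B_d^2=\langle x^2: x\in B_d\rangle$. For a nonzero ideal $\pi$ of $O_d$, $B_d(\pi)=\{x\in B_d:x\equiv\pm I\pmod\pi\}$. A subgroup of $B_d$ is congruence if it contains $B_d(\pi)$ for some nonzero ideal $\pi\subseteq O_d$, and non-congruence otherwise. *)

theory Defs
  imports "HOL-Analysis.Determinants" "HOL-Analysis.Complex_Transcendental"
    "HOL-Computational_Algebra.Polynomial" "HOL-Computational_Algebra.Squarefree"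
    "HOL-Algebra.Generated_Groups" "HOL-Algebra.Ideal"
begin

definition quadratic_field :: "int \<Rightarrow> complex set" where
  "quadratic_field d = {of_rat a + of_rat b * csqrt (of_int d) | a b. True}"

definition ring_of_integers :: "int \<Rightarrow> complex ring" where
  "ring_of_integers d =
     \<lparr>carrier = {z \<in> quadratic_field d. algebraic_int z},
      mult = (*), one = 1, zero = 0, add = (+)\<rparr>"

definition SL2 :: "int \<Rightarrow> (complex^2^2) monoid" where
  "SL2 d =
     \<lparr>carrier = {A. (\<forall>i j. A $ i $ j \<in> carrier (ring_of_integers d)) \<and> det A = 1},
      mult = (**), one = mat 1\<rparr>"

text \<open>The elements of the Bianchi group are the cosets \<open>{A, - A}\<close>.\<close>

definition bianchi_group :: "int \<Rightarrow> (complex^2^2) set monoid" where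
  "bianchi_group d = SL2 d Mod {mat 1, - mat 1}"

definition commutator_subgroup :: "int \<Rightarrow> (complex^2^2) set set" where
  "commutator_subgroup d = derived (bianchi_group d) (carrier (bianchi_group d))"

definition square_subgroup :: "int \<Rightarrow> (complex^2^2) set set" where
  "square_subgroup d = generate (bianchi_group d)
     {x [^]\<^bsub>bianchi_group d\<^esub> (2::nat) | x. x \<in> carrier (bianchi_group d)}"

definition matrix_cong :: "complex set \<Rightarrow> complex^2^2 \<Rightarrow> complex^2^2 \<Rightarrow> bool" where
  "matrix_cong \<pi> A B \<longleftrightarrow> (\<forall>i j. A $ i $ j - B $ i $ j \<in> \<pi>)"

text \<open>For an ideal \<open>\<pi>\<close>, the condition below holds for one representative of the coset \<open>x\<close>
  if and only if it holds for the other.\<close>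

definition principal_congruence_subgroup :: "int \<Rightarrow> complex set \<Rightarrow> (complex^2^2) set set" where
  "principal_congruence_subgroup d \<pi> =
     {x \<in> carrier (bianchi_group d).
        \<exists>A\<in>x. matrix_cong \<pi> A (mat 1) \<or> matrix_cong \<pi> A (- mat 1)}"

definition congruence_subgroup :: "int \<Rightarrow> (complex^2^2) set set \<Rightarrow> bool" where
  "congruence_subgroup d H \<longleftrightarrow> subgroup H (bianchi_group d) \<and>
     (\<exists>\<pi>. ideal \<pi> (ring_of_integers d) \<and> \<pi> \<noteq> {0} \<and> principal_congruence_subgroup d \<pi> \<subseteq> H)"

definition noncongruence_subgroup :: "int \<Rightarrow> (complex^2^2) set set \<Rightarrow> bool" where
  "noncongruence_subgroup d H \<longleftrightarrow> subgroup H (bianchi_group d) \<and> \<not> congruence_subgroup d H"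

end

theory Submission
  imports Defs
begin

text \<open>
  For \<open>d \<noteq> -3\<close> we use a homomorphism from \<open>B_d\<close> to \<open>\<int>/2\<close>, in the spirit of Zimmert.
  Hyperbolic 3-space carries a locally finite, \<open>B_d\<close>-invariant family of totally geodesic planes
  that contains the vertical plane \<open>Im z = 0\<close>.  The homomorphism sends \<open>g\<close> to the parity
  of the number of planes of the family that separate \<open>j\<close> from \<open>g j\<close>.  Only the vertical planes
  \<open>Im z = k \<surd>\<bar>d\<bar> / 2\<close> reach the height of \<open>j\<close>, so the translation by
  \<open>\<omega> = (1 + \<surd>d) / 2\<close> crosses exactly one plane and has odd parity.  Squares and commutators
  have even parity.  Suppose that all elements congruent to the identity modulo \<open>n = 2^t m\<close>, with
  \<open>m\<close> odd, had even parity too.  As \<open>2\<close> is inert, \<open>\<omega>\<close> is invertible modulo \<open>2^t\<close>;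
  conjugating the translation by \<open>m y\<close> with a matrix that is congruent to
  \<open>diag(\<omega>, \<omega>\<^sup>-\<^sup>1)\<close> modulo \<open>2^t\<close> yields, modulo \<open>n\<close>, the translation by
  \<open>\<omega>\<^sup>2 m y\<close>, so the translation by \<open>(1 - \<omega>\<^sup>2) m y\<close> is even for all \<open>y\<close>.  The norm of
  \<open>1 - \<omega>\<^sup>2\<close> is odd, so some odd multiple of \<open>\<omega>\<close> is among these, a contradiction.

  For \<open>d = -3\<close> the ring is Euclidean, so the group is generated by translations and
  \<open>z \<mapsto> -1/z\<close>, and its abelianization is generated by the class of \<open>z + 1\<close>, of order
  dividing 3.  A formula for this class in terms of the matrix entries modulo
  \<open>\<surd>-3\<close> shows that the commutator subgroup contains \<open>B_d(\<surd>-3)\<close>.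
\<close>

section \<open>Quadratic integers\<close>

lemma matrix_2_eq_iff:
  fixes A B :: "'a^2^2"
  shows "A = B \<longleftrightarrow> A$1$1 = B$1$1 \<and> A$1$2 = B$1$2 \<and> A$2$1 = B$2$1 \<and> A$2$2 = B$2$2"
  by (auto simp: vec_eq_iff forall_2)

lemma matrix_matrix_mult_2:
  fixes A B :: "'a::comm_ring_1^2^2"
  shows "(A ** B) $ i $ j = A$i$1 * B$1$j + A$i$2 * B$2$j"
  by (simp add: matrix_matrix_mult_def sum_2)

section \<open>Integer polynomials and algebraic integers of degree two\<close>

lemma map_poly_of_int_add:
  "map_poly of_int (p + q) = (map_poly of_int p + map_poly of_int q :: complex poly)"
  by (rule poly_eqI) (simp add: coeff_map_poly)

lemma map_poly_of_int_mult:
  "map_poly of_int (p * q) = (map_poly of_int p * map_poly of_int q :: complex poly)"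
  by (rule poly_eqI) (simp add: coeff_map_poly coeff_mult)

text \<open>Gauss's lemma: pseudo-division of a monic \<open>p\<close> gives
  \<open>a p = q h\<close>. Comparing contents, the content of \<open>h\<close> is \<open>a\<close>
  up to sign, so \<open>a\<close> divides the leading coefficient of \<open>h\<close>; cancelling it
  leaves the leading coefficient of \<open>q\<close> as a divisor of 1.\<close>

lemma primitive_quadratic_lead_coeff_unit:
  fixes q :: "int poly" and z :: complex
  assumes z: "algebraic_int z" "Im z \<noteq> 0"
    and q: "degree q = 2" "content q = 1" "poly (map_poly of_int q) z = 0"
  shows "is_unit (lead_coeff q)"
proof -
  let ?f = "\<lambda>p. poly (map_poly of_int p) z"
  obtain p where p: "?f p = 0" "lead_coeff p = 1"
    using z(1) by (auto simp: algebraic_int_altdef_ipoly)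
  have "q \<noteq> 0" using q(1) by auto
  obtain a h where a: "a \<noteq> 0" "smult a p = q * h + pseudo_mod p q"
    using pseudo_mod(1)[OF \<open>q \<noteq> 0\<close>] by blast
  let ?r = "pseudo_mod p q"
  have r: "?r = 0 \<or> degree ?r < 2"
    using pseudo_mod(2)[OF \<open>q \<noteq> 0\<close>] q(1) by auto
  have "?f (smult a p) = ?f q * ?f h + ?f ?r"
    unfolding a(2) by (simp add: map_poly_of_int_add map_poly_of_int_mult)
  then have fr: "?f ?r = 0"
    using p(1) q(3) by (simp add: map_poly_smult)
  \<comment> \<open>The remainder is at most linear with integer coefficients, so it cannot vanish
    at a non-real number unless it is zero.\<close>
  have r0: "?r = 0"
  proof (rule ccontr)
    assume "?r \<noteq> 0"
    then have "degree ?r \<le> 1" using r by auto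
    then obtain u v where uv: "?r = [:u, v:]"
      by (metis degree1_coeffs degree_eq_zeroE le_neq_implies_less less_one pCons_0_0)
    have "of_int u + z * of_int v = 0"
      using fr by (simp add: uv map_poly_pCons)
    then have "Im (of_int u + z * of_int v) = 0" "Re (of_int u + z * of_int v) = 0" by auto
    then have "v = 0" using z(2) by auto
    then have "u = 0" using \<open>Re (of_int u + z * of_int v) = 0\<close> by auto
    then show False using \<open>v = 0\<close> uv \<open>?r \<noteq> 0\<close> by auto
  qed
  have cp: "content p = 1"
    using content_dvd_coeff[of p "degree p"] p(2) by (auto simp flip: is_unit_content_iff)
  have "content (smult a p) = content q * content h"
    unfolding a(2) r0 by (simp add: content_mult)
  then have "content h = normalize a" using cp q(2) by (simp add: content_smult)
  then have "a dvd lead_coeff h"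
    by (metis content_dvd_coeff normalize_dvd_iff)
  then obtain c where c: "lead_coeff h = a * c" by (auto elim: dvdE)
  have "lead_coeff (smult a p) = lead_coeff q * lead_coeff h"
    unfolding a(2) r0 by (simp add: lead_coeff_mult)
  moreover have "lead_coeff (smult a p) = a" using p(2) a(1) by simp
  ultimately have "a * (lead_coeff q * c) = a * 1"
    unfolding c by (simp only: mult_ac mult_1_right)
  then have "lead_coeff q * c = 1" using a(1) mult_cancel_left by blast
  then show ?thesis by (metis dvd_triv_left)
qed

text \<open>Clearing denominators gives an integer quadratic \<open>p\<close> with leading
  coefficient \<open>k\<close>. Its primitive part has a unit in front, so \<open>k\<close> divides
  the content and hence every coefficient of \<open>p\<close>.\<close>

lemma algebraic_int_quadratic_coeffs:
  fixes z :: complex and t n :: rat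
  assumes z: "algebraic_int z" "Im z \<noteq> 0" "z\<^sup>2 - of_rat t * z + of_rat n = 0"
  shows "t \<in> \<int>" "n \<in> \<int>"
proof -
  obtain t1 t2 where t: "t = of_int t1 / of_int t2" "t2 > 0"
    by (metis Rat_cases_nonzero Fract_of_int_quotient of_int_0 div_0 zero_less_one)
  obtain n1 n2 where n: "n = of_int n1 / of_int n2" "n2 > 0"
    by (metis Rat_cases_nonzero Fract_of_int_quotient of_int_0 div_0 zero_less_one)
  define k where "k = t2 * n2"
  define p where "p = [:n1 * t2, - t1 * n2, k:]"
  have k: "k > 0" using t n by (simp add: k_def)
  have degp: "degree p = 2" and p0: "p \<noteq> 0" using k by (auto simp: p_def)
  have "poly (map_poly of_int p) z = of_int k * (z\<^sup>2 - of_rat t * z + of_rat n)"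
    using t(2) n(2) unfolding p_def k_def t(1) n(1)
    by (simp add: map_poly_pCons of_rat_divide of_rat_mult field_simps power2_eq_square)
  then have pz: "poly (map_poly of_int p) z = 0" using z(3) by simp
  let ?q = "primitive_part p"
  have pq: "p = smult (content p) ?q" by simp
  have c0: "content p \<noteq> 0" using p0 by simp
  have dq: "degree ?q = 2" using degp by simp
  have "of_int (content p) * poly (map_poly of_int ?q) z = 0"
    using pz by (subst (asm) pq) (simp add: map_poly_smult del: content_times_primitive_part)
  then have "poly (map_poly of_int ?q) z = 0" using c0 p0 by simp
  then have "is_unit (lead_coeff ?q)"
    using primitive_quadratic_lead_coeff_unit[OF z(1,2) dq] p0 by simp
  moreover have "k = content p * lead_coeff ?q"
    using pq degp by (metis coeff_smult dq p_def One_nat_def Suc_1 coeff_pCons_0 coeff_pCons_Suc)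
  ultimately have "k dvd content p"
    by (metis dvd_refl mult_unit_dvd_iff)
  then have "k dvd coeff p 0" "k dvd coeff p 1" using dvd_trans content_dvd_coeff by blast+
  then have "k dvd n1 * t2" "k dvd t1 * n2" by (auto simp: p_def)
  then have "n2 dvd n1" "t2 dvd t1" using t(2) n(2) by (auto simp: k_def mult.commute)
  then show "t \<in> \<int>" "n \<in> \<int>" using t n by (auto elim!: dvdE)
qed

definition mat2 :: "'a \<Rightarrow> 'a \<Rightarrow> 'a \<Rightarrow> 'a \<Rightarrow> 'a::zero^2^2" where
  "mat2 a b c e = vector [vector [a, b], vector [c, e]]"

lemma mat2_nth [simp]:
  "mat2 a b c e $ 1 $ 1 = a" "mat2 a b c e $ 1 $ 2 = b"
  "mat2 a b c e $ 2 $ 1 = c" "mat2 a b c e $ 2 $ 2 = e"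
  by (simp_all add: mat2_def)

lemma mat_1_nth [simp]:
  "(mat 1 :: 'a::zero_neq_one^2^2) $ 1 $ 1 = 1" "(mat 1 :: 'a::zero_neq_one^2^2) $ 1 $ 2 = 0"
  "(mat 1 :: 'a::zero_neq_one^2^2) $ 2 $ 1 = 0" "(mat 1 :: 'a::zero_neq_one^2^2) $ 2 $ 2 = 1"
  by (simp_all add: mat_def)

lemma mat2_eta: "mat2 (A$1$1) (A$1$2) (A$2$1) (A$2$2) = A"
  by (simp add: matrix_2_eq_iff)

lemma mat2_mult:
  "mat2 a b c e ** mat2 a' b' c' e' =
   (mat2 (a * a' + b * c') (a * b' + b * e') (c * a' + e * c') (c * b' + e * e') :: 'a::comm_ring_1^2^2)"
  by (simp add: matrix_2_eq_iff matrix_matrix_mult_2)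

lemma det_mat2: "det (mat2 a b c e :: 'a::comm_ring_1^2^2) = a * e - b * c"
  by (simp add: det_2)

lemma even_card_symmetric_difference:
  assumes "finite A" "finite B"
  shows "even (card ((A - B) \<union> (B - A))) \<longleftrightarrow> even (card A) = even (card B)"
proof -
  have "card ((A - B) \<union> (B - A)) = card (A - B) + card (B - A)"
    using assms by (intro card_Un_disjoint) auto
  moreover have "card A = card (A - B) + card (A \<inter> B)"
    using assms by (subst card_Un_disjoint[symmetric]) (auto intro: arg_cong[of _ _ card])
  moreover have "card B = card (B - A) + card (A \<inter> B)"
    using assms by (subst card_Un_disjoint[symmetric]) (auto intro: arg_cong[of _ _ card])
  ultimately show ?thesis by simp presburger
qed

section \<open>The ring of integers as the lattice with basis 1, \<open>w\<close>\<close>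

locale imaginary_quadratic =
  fixes d :: int
  assumes d_neg: "d < 0" and d_squarefree: "squarefree d" and d_mod_4: "d mod 4 = 1"
begin

definition s :: complex where "s = csqrt (of_int d)"
definition w :: complex where "w = (1 + s) / 2"
text \<open>The norm of \<open>w\<close>, whose minimal polynomial is X^2 - X + N. It is odd exactly
  when d is 5 modulo 8.\<close>

definition N :: int where "N = (1 - d) div 4"
definition O_d :: "complex set" where "O_d = range (\<lambda>(x, y). of_int x + of_int y * w)"

lemma s_eq: "s = \<i> * of_real (sqrt (- real_of_int d))"
proof -
  have "of_int d = (of_real (real_of_int d) :: complex)" by simp
  then show ?thesis
    unfolding s_def using d_neg by (simp only:) (subst csqrt_of_real_nonpos, auto)
qed

lemma s_squared: "s * s = of_int d"
  unfolding s_def by (metis power2_csqrt power2_eq_square)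

lemma cnj_s [simp]: "cnj s = - s" and Re_s [simp]: "Re s = 0"
  and Im_s_pos: "Im s > 0" and Im_s_squared: "Im s * Im s = - of_int d"
  using d_neg by (auto simp: s_eq)

lemma s_nonzero [simp]: "s \<noteq> 0" using Im_s_pos by auto

lemma d_eq: "d = 1 - 4 * N"
  using d_mod_4 unfolding N_def by presburger

lemma w_squared: "w * w = w - of_int N"
proof -
  have "4 * (w * w) = 1 + 2 * s + s * s" by (simp add: w_def algebra_simps)
  also have "\<dots> = 4 * (w - of_int N)"
    unfolding s_squared by (subst d_eq) (simp add: w_def field_simps)
  finally show ?thesis by (metis mult_cancel_left zero_neq_numeral)
qed

lemma cnj_w: "cnj w = 1 - w" by (simp add: w_def field_simps)

lemma s_eq_w: "s = 2 * w - 1" by (simp add: w_def field_simps)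

lemma O_iff: "z \<in> O_d \<longleftrightarrow> (\<exists>x y. z = of_int x + of_int y * w)"
  unfolding O_d_def by auto

lemma O_I: "z = of_int x + of_int y * w \<Longrightarrow> z \<in> O_d"
  using O_iff by blast

lemma O_of_int [simp, intro]: "of_int x \<in> O_d" by (rule O_I[of _ x 0]) simp
lemma O_0 [simp, intro]: "0 \<in> O_d"
  and O_1 [simp, intro]: "1 \<in> O_d" and O_numeral [simp, intro]: "numeral k \<in> O_d"
  using O_of_int[of 0] O_of_int[of 1] O_of_int[of "numeral k"] by auto
lemma O_w [simp, intro]: "w \<in> O_d" by (rule O_I[of _ 0 1]) simp

lemma O_add [simp, intro]:
  assumes "a \<in> O_d" "b \<in> O_d" shows "a + b \<in> O_d"
proof -
  obtain x y x' y' where "a = of_int x + of_int y * w" "b = of_int x' + of_int y' * w"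
    using assms O_iff by auto
  then have "a + b = of_int (x + x') + of_int (y + y') * w" by (simp add: algebra_simps)
  then show ?thesis by (rule O_I)
qed

lemma O_uminus [simp, intro]: "a \<in> O_d \<Longrightarrow> - a \<in> O_d"
  unfolding O_iff by (clarify, rename_tac x y, rule_tac x = "- x" in exI, rule_tac x = "- y" in exI) simp

lemma O_diff [simp, intro]: "a \<in> O_d \<Longrightarrow> b \<in> O_d \<Longrightarrow> a - b \<in> O_d"
  using O_add[of a "- b"] by simp

lemma O_mult [simp, intro]:
  assumes "a \<in> O_d" "b \<in> O_d" shows "a * b \<in> O_d"
proof -
  obtain x y x' y' where ab: "a = of_int x + of_int y * w" "b = of_int x' + of_int y' * w"
    using assms O_iff by auto
  have "a * b = of_int (x * x') + of_int (x * y' + y * x') * w + of_int (y * y') * (w * w)"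
    by (simp add: ab algebra_simps)
  also have "\<dots> = of_int (x * x' - y * y' * N) + of_int (x * y' + y * x' + y * y') * w"
    unfolding w_squared by (simp add: algebra_simps)
  finally show ?thesis by (rule O_I)
qed

lemma O_cnj [simp, intro]:
  assumes "a \<in> O_d" shows "cnj a \<in> O_d"
proof -
  obtain x y where a: "a = of_int x + of_int y * w" using assms O_iff by auto
  have "cnj a = of_int (x + y) + of_int (- y) * w" by (simp add: a cnj_w algebra_simps)
  then show ?thesis by (rule O_I)
qed

lemma O_s [simp, intro]: "s \<in> O_d" unfolding s_eq_w by auto

lemma O_coords_unique:
  "of_int x + of_int y * w = of_int x' + of_int y' * w \<longleftrightarrow> x = x' \<and> y = y'"
proof
  assume eq: "of_int x + of_int y * w = of_int x' + of_int y' * w"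
  have "Im (of_int x + of_int y * w) = Im (of_int x' + of_int y' * w)" using eq by simp
  then have "y = y'" using Im_s_pos by (simp add: w_def)
  then show "x = x' \<and> y = y'" using eq by simp
qed auto

lemma algebraic_int_O:
  assumes "a \<in> O_d" shows "algebraic_int a"
proof -
  obtain x y where a: "a = of_int x + of_int y * w" using assms O_iff by auto
  let ?p = "[: x\<^sup>2 + x * y + y\<^sup>2 * N, - (2 * x + y), 1:]"
  have "poly (map_poly of_int ?p) a = of_int (y\<^sup>2) * (w * w - w + of_int N)"
    by (simp add: a map_poly_pCons algebra_simps power2_eq_square)
  also have "\<dots> = 0" unfolding w_squared by simp
  finally show ?thesis unfolding algebraic_int_altdef_ipoly
    by (intro exI[of _ ?p]) auto
qed

text \<open>The trace \<open>2 a\<close> and the norm of \<open>z\<close> are integers, hence so is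
  d (2b)^2. Square-freeness of \<open>d\<close> then removes the denominator of \<open>2 b\<close>,
  and \<open>d\<close> being 1 modulo 4 forces \<open>2 a\<close> and \<open>2 b\<close> to have the
  same parity.\<close>

lemma algebraic_int_imp_O:
  assumes "z \<in> quadratic_field d" "algebraic_int z" shows "z \<in> O_d"
proof -
  obtain a b where z: "z = of_rat a + of_rat b * s"
    using assms(1) unfolding quadratic_field_def s_def by blast
  show ?thesis
  proof (cases "b = 0")
    case True
    then have "z \<in> \<int>" using rational_algebraic_int_is_int[OF assms(2)] z by simp
    then show ?thesis by (auto elim!: Ints_cases)
  next
    case False
    have cnj_rat: "cnj (of_rat r) = of_rat r" for r
      by (cases r) (simp add: of_rat_rat)
    have re: "Im (of_rat r) = 0" "Re (of_rat r) = of_rat r" for r :: rat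
      by (cases r, simp add: of_rat_rat Im_divide Re_divide power2_eq_square)+
    have imz: "Im z \<noteq> 0" using False Im_s_pos by (simp add: z re)
    have "z\<^sup>2 - of_rat (2 * a) * z + of_rat (a\<^sup>2 - of_int d * b\<^sup>2) = of_rat (b\<^sup>2) * (s * s - of_int d)"
      by (simp add: z algebra_simps power2_eq_square of_rat_add of_rat_mult of_rat_diff)
    then have "z\<^sup>2 - of_rat (2 * a) * z + of_rat (a\<^sup>2 - of_int d * b\<^sup>2) = 0"
      unfolding s_squared by simp
    from algebraic_int_quadratic_coeffs[OF assms(2) imz this]
    obtain x n where x: "2 * a = of_int x" and n: "a\<^sup>2 - of_int d * b\<^sup>2 = of_int n"
      by (auto elim!: Ints_cases)
    obtain y1 y2 where y: "2 * b = of_int y1 / of_int y2" "y2 > 0" "coprime y1 y2"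
      by (metis Rat_cases Fract_of_int_quotient)
    have "of_int d * (2 * b)\<^sup>2 = (2 * a)\<^sup>2 - of_int (4 * n)"
      using n by (simp add: power2_eq_square algebra_simps)
    then have "of_int (d * y1\<^sup>2) = (of_int ((x\<^sup>2 - 4 * n) * y2\<^sup>2) :: rat)"
      unfolding x y(1) using y(2) by (simp add: field_simps)
    then have eq: "d * y1\<^sup>2 = (x\<^sup>2 - 4 * n) * y2\<^sup>2" using of_int_eq_iff by blast
    then have "y2\<^sup>2 dvd d * y1\<^sup>2" by simp
    moreover have "coprime (y2\<^sup>2) (y1\<^sup>2)" using y(3) by (simp add: coprime_commute)
    ultimately have "y2\<^sup>2 dvd d" using coprime_dvd_mult_left_iff by blast
    then have "is_unit y2" using squarefreeD d_squarefree by blast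
    then have y2: "y2 = 1" using y(2) by simp
    have "even (x - y1)"
    proof -
      have "x\<^sup>2 - y1\<^sup>2 = 4 * (n - N * y1\<^sup>2)" using eq unfolding y2
        by (subst (asm) d_eq) (simp add: algebra_simps)
      then have "even (x\<^sup>2 - y1\<^sup>2)" by simp
      then show ?thesis by simp
    qed
    then obtain u where u: "x - y1 = 2 * u" using dvdE by blast
    have "2 * z = of_int x + of_int y1 * s"
    proof -
      have "2 * z = of_rat (2 * a) + of_rat (2 * b) * s" by (simp add: z of_rat_mult algebra_simps)
      then show ?thesis unfolding x y(1) y2 by simp
    qed
    also have "\<dots> = of_int (x - y1) + 2 * of_int y1 * w" by (simp add: s_eq_w algebra_simps)
    also have "\<dots> = 2 * (of_int u + of_int y1 * w)" unfolding u by (simp add: algebra_simps)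
    finally have "z = of_int u + of_int y1 * w" by (metis mult_cancel_left zero_neq_numeral)
    then show ?thesis by (rule O_I)
  qed
qed

lemma O_imp_quadratic_field:
  assumes "a \<in> O_d" shows "a \<in> quadratic_field d"
proof -
  obtain x y where a: "a = of_int x + of_int y * w" using assms O_iff by auto
  have "a = of_rat (of_int x + of_int y / 2) + of_rat (of_int y / 2) * s"
    by (simp add: a w_def of_rat_add of_rat_mult of_rat_divide field_simps)
  then show ?thesis unfolding quadratic_field_def s_def by blast
qed

lemma carrier_ring_of_integers: "carrier (ring_of_integers d) = O_d"
  using algebraic_int_imp_O algebraic_int_O O_imp_quadratic_field
  by (auto simp: ring_of_integers_def)

text \<open>The imaginary part bounds the coordinate along \<open>w\<close>, and then the real part
  bounds the other one. This feeds the local finiteness of the family of planes.\<close>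

lemma finite_O_bounded: "finite {a \<in> O_d. cmod a \<le> R}"
proof -
  let ?K = "R / (Im s / 2)"
  define M where "M = \<lceil>?K\<rceil>"
  define M' where "M' = \<lceil>R + \<bar>?K\<bar>\<rceil>"
  have "{a \<in> O_d. cmod a \<le> R} \<subseteq> (\<lambda>(x, y). of_int x + of_int y * w) ` ({- M'..M'} \<times> {- M..M})"
  proof
    fix a assume "a \<in> {a \<in> O_d. cmod a \<le> R}"
    then obtain x y where a: "a = of_int x + of_int y * w" and R: "cmod a \<le> R" using O_iff by auto
    have "\<bar>Im a\<bar> \<le> R" "\<bar>Re a\<bar> \<le> R" using R abs_Im_le_cmod abs_Re_le_cmod order_trans by blast+
    then have 1: "\<bar>of_int y\<bar> * (Im s / 2) \<le> R" and 2: "\<bar>of_int x + of_int y / 2\<bar> \<le> R"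
      using Im_s_pos by (auto simp: a w_def abs_mult)
    have y: "\<bar>of_int y\<bar> \<le> ?K" using 1 Im_s_pos by (simp add: field_simps)
    then have "\<bar>y\<bar> \<le> M" unfolding M_def by linarith
    moreover have "\<bar>of_int x\<bar> \<le> R + \<bar>?K\<bar>" using 2 y by linarith
    then have "\<bar>x\<bar> \<le> M'" unfolding M'_def by linarith
    ultimately show "a \<in> (\<lambda>(x, y). of_int x + of_int y * w) ` ({- M'..M'} \<times> {- M..M})"
      using a by force
  qed
  then show ?thesis by (rule finite_subset) auto
qed

section \<open>The Bianchi group\<close>

abbreviation SL where "SL \<equiv> carrier (SL2 d)"

lemma SL_iff:
  "A \<in> SL \<longleftrightarrow> A$1$1 \<in> O_d \<and> A$1$2 \<in> O_d \<and> A$2$1 \<in> O_d \<and> A$2$2 \<in> O_d \<and> A$1$1 * A$2$2 - A$1$2 * A$2$1 = 1"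
  by (auto simp: SL2_def carrier_ring_of_integers forall_2 det_2)

lemma mat2_SL_iff:
  "mat2 a b c e \<in> SL \<longleftrightarrow> a \<in> O_d \<and> b \<in> O_d \<and> c \<in> O_d \<and> e \<in> O_d \<and> a * e - b * c = 1"
  by (simp add: SL_iff)

lemma mult_SL2 [simp]: "A \<otimes>\<^bsub>SL2 d\<^esub> B = A ** B" and one_SL2 [simp]: "\<one>\<^bsub>SL2 d\<^esub> = mat 1"
  by (simp_all add: SL2_def)

lemma SL_mult [simp, intro]: "A \<in> SL \<Longrightarrow> B \<in> SL \<Longrightarrow> A ** B \<in> SL"
  by (auto simp: SL2_def carrier_ring_of_integers det_mul matrix_matrix_mult_2)

lemma SL_one [simp, intro]: "mat 1 \<in> SL" and SL_minus_one [simp, intro]: "- mat 1 \<in> SL"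
  by (auto simp: SL_iff)

definition adjugate :: "complex^2^2 \<Rightarrow> complex^2^2" where
  "adjugate A = mat2 (A$2$2) (- A$1$2) (- A$2$1) (A$1$1)"

lemma adjugate_SL: "A \<in> SL \<Longrightarrow> adjugate A \<in> SL"
  by (auto simp: SL_iff adjugate_def mult.commute)

lemma adjugate_mult: "A \<in> SL \<Longrightarrow> adjugate A ** A = mat 1"
  and mult_adjugate: "A \<in> SL \<Longrightarrow> A ** adjugate A = mat 1"
  by (auto simp: SL_iff adjugate_def matrix_2_eq_iff matrix_matrix_mult_2 algebra_simps)

sublocale SL: group "SL2 d"
  by (rule groupI) (use adjugate_SL adjugate_mult in \<open>auto simp: matrix_mul_assoc\<close>)

lemma inv_SL: "A \<in> SL \<Longrightarrow> inv\<^bsub>SL2 d\<^esub> A = adjugate A"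
  using SL.inv_equality adjugate_SL adjugate_mult by simp

lemma minus_one_mult: "(- mat 1) ** A = - A" "A ** (- mat 1) = (- A :: complex^2^2)"
  by (auto simp: matrix_2_eq_iff matrix_matrix_mult_2)

lemma minus_SL: "A \<in> SL \<Longrightarrow> - A \<in> SL"
  by (auto simp: SL_iff)

sublocale pm: normal "{mat 1, - mat 1}" "SL2 d"
proof -
  have "subgroup {mat 1, - mat 1} (SL2 d)"
  proof (rule SL.subgroupI)
    have "adjugate (mat 1) = mat 1" "adjugate (- mat 1) = - mat 1"
      by (simp_all add: adjugate_def matrix_2_eq_iff)
    then show "inv\<^bsub>SL2 d\<^esub> A \<in> {mat 1, - mat 1}" if "A \<in> {mat 1, - mat 1}" for A
      using that by (auto simp: inv_SL)
  qed (auto simp: minus_one_mult)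
  moreover have "x ** (- mat 1) ** adjugate x = - mat 1" if "x \<in> SL" for x
    using that unfolding minus_one_mult by (auto simp: SL_iff adjugate_def matrix_2_eq_iff matrix_matrix_mult_2 algebra_simps)
  ultimately show "{mat 1, - mat 1} \<lhd> SL2 d"
    by (subst SL.normal_inv_iff) (auto simp: inv_SL mult_adjugate)
qed

definition cls :: "complex^2^2 \<Rightarrow> (complex^2^2) set" where "cls A = {mat 1, - mat 1} #>\<^bsub>SL2 d\<^esub> A"

lemma cls_eq: "cls A = {A, - A}"
  by (auto simp: cls_def r_coset_def minus_one_mult)

sublocale PSL: group "bianchi_group d"
  unfolding bianchi_group_def by (rule pm.factorgroup_is_group)

lemma carrier_bianchi: "carrier (bianchi_group d) = cls ` SL"
  by (simp add: bianchi_group_def carrier_FactGroup cls_def)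

sublocale cls: group_hom "SL2 d" "bianchi_group d" cls
  by unfold_locales (use pm.r_coset_hom_Mod in \<open>simp add: bianchi_group_def cls_def[abs_def]\<close>)

lemma cls_in_bianchi [simp, intro]: "A \<in> SL \<Longrightarrow> cls A \<in> carrier (bianchi_group d)"
  using carrier_bianchi by auto

section \<open>Counting separating planes modulo 2\<close>

text \<open>The conjugate transpose.\<close>

definition hadj :: "complex^2^2 \<Rightarrow> complex^2^2" where
  "hadj A = mat2 (cnj (A$1$1)) (cnj (A$2$1)) (cnj (A$1$2)) (cnj (A$2$2))"

definition act :: "complex^2^2 \<Rightarrow> complex^2^2 \<Rightarrow> complex^2^2" where
  "act g M = hadj g ** M ** g"

text \<open>
  A plane is given by a skew-hermitian matrix \<open>M\<close>, as the zero set of the hermitian form \<open>s M\<close>.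
  The congruence \<open>b \<equiv> 1 (mod s)\<close> picks one of the two orientations of each plane, which is why
  the family does not contain both \<open>M\<close> and \<open>- M\<close>; the last equation says \<open>det M = 1\<close>.
\<close>

definition walls :: "(complex^2^2) set" where
  "walls = {mat2 (of_int k * s) b (- cnj b) (of_int l * s) | k l b.
     b \<in> O_d \<and> (\<exists>m\<in>O_d. b = 1 + s * m) \<and> b * cnj b = 1 - of_int (d * k * l)}"

text \<open>The trace of \<open>M\<close> is its value at the base point \<open>j\<close>, up to a factor.\<close>

definition pos_side :: "complex^2^2 \<Rightarrow> bool" where
  "pos_side M \<longleftrightarrow> Im (M$1$1 + M$2$2) < 0"

text \<open>The value of \<open>act g M\<close> at \<open>j\<close> is the value of \<open>M\<close>
  at g j, so these are the planes that separate \<open>j\<close> from g j. A plane through a point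
  counts as having that point on its non-positive side.\<close>

definition flips :: "complex^2^2 \<Rightarrow> (complex^2^2) set" where
  "flips g = {M \<in> walls. pos_side M \<noteq> pos_side (act g M)}"

lemma imag_mult: "of_int k * s * (of_int l * s) = of_int (d * k * l)"
proof -
  have "of_int k * s * (of_int l * s) = of_int k * of_int l * (s * s)" by (simp add: mult_ac)
  then show ?thesis unfolding s_squared by simp
qed

text \<open>A description free of the coordinates \<open>k\<close> and \<open>l\<close>, against
  which invariance under \<open>act\<close> can be checked entry by entry.\<close>

lemma walls_iff:
  "M \<in> walls \<longleftrightarrow> M$1$1 \<in> O_d \<and> M$2$2 \<in> O_d \<and> cnj (M$1$1) = - M$1$1 \<and> cnj (M$2$2) = - M$2$2 \<and>
     M$2$1 = - cnj (M$1$2) \<and> (\<exists>m\<in>O_d. M$1$2 = 1 + s * m) \<and> M$1$1 * M$2$2 - M$1$2 * M$2$1 = 1"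
  (is "_ \<longleftrightarrow> ?R")
proof
  assume "M \<in> walls"
  then obtain k l b where M: "M = mat2 (of_int k * s) b (- cnj b) (of_int l * s)" "b \<in> O_d"
    "\<exists>m\<in>O_d. b = 1 + s * m" "b * cnj b = 1 - of_int (d * k * l)"
    unfolding walls_def by blast
  have "of_int k * s * (of_int l * s) + b * cnj b = 1" unfolding M(4) imag_mult by simp
  then show ?R using M(2,3) unfolding M(1) by auto
next
  \<comment> \<open>The trace 2x + y of such an element vanishes, which leaves an integer multiple
    of \<open>s\<close>.\<close>
  have imag: "\<exists>k. a = of_int k * s" if a: "a \<in> O_d" "cnj a = - a" for a
  proof -
    obtain x y where xy: "a = of_int x + of_int y * w" using a(1) O_iff by auto
    have "of_int (2 * x + y) = a + cnj a" by (simp add: xy cnj_w algebra_simps)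
    then have "2 * x + y = 0" unfolding a(2) by (simp only: add.right_inverse of_int_eq_0_iff)
    then have "y = - 2 * x" by simp
    then have "a = of_int (- x) * s" by (simp add: xy s_eq_w algebra_simps)
    then show ?thesis by blast
  qed
  assume R: ?R
  obtain k l where kl: "M$1$1 = of_int k * s" "M$2$2 = of_int l * s" using imag R by meson
  have "M$1$2 \<in> O_d" using R by auto
  moreover have "M$1$2 * cnj (M$1$2) = 1 - of_int (d * k * l)"
  proof -
    have "M$1$2 * M$2$1 = - (M$1$2 * cnj (M$1$2))" using R by simp
    moreover have "M$1$1 * M$2$2 - M$1$2 * M$2$1 = 1" using R by blast
    ultimately show ?thesis unfolding kl imag_mult by (simp add: algebra_simps)
  qed
  moreover have "M = mat2 (of_int k * s) (M$1$2) (- cnj (M$1$2)) (of_int l * s)"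
    using R kl by (simp add: matrix_2_eq_iff)
  ultimately show "M \<in> walls" unfolding walls_def using R by blast
qed

lemma hadj_mult: "hadj (A ** B) = hadj B ** hadj A"
  by (simp add: hadj_def matrix_2_eq_iff matrix_matrix_mult_2 algebra_simps)

lemma act_mult: "act (g ** h) M = act h (act g M)"
  by (simp add: act_def hadj_mult matrix_mul_assoc)

lemma act_one: "act (mat 1) M = M" and act_minus_one: "act (- mat 1) M = M"
proof -
  have "hadj (mat 1) = mat 1" "hadj (- mat 1) = - mat 1"
    by (simp_all add: hadj_def matrix_2_eq_iff)
  then show "act (mat 1) M = M" "act (- mat 1) M = M"
    by (simp_all add: act_def minus_one_mult)
qed

text \<open>Conjugation is trivial modulo \<open>s\<close>, because \<open>w\<close> and its
  conjugate \<open>1 - w\<close> differ by \<open>s\<close>.\<close>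

lemma cnj_cong_s: assumes "a \<in> O_d" obtains m where "m \<in> O_d" "cnj a = a + s * m"
proof -
  obtain x y where xy: "a = of_int x + of_int y * w" using assms O_iff by auto
  have "cnj a = a + s * of_int (- y)" by (simp add: xy cnj_w s_eq_w algebra_simps)
  then show thesis using that by blast
qed

text \<open>Modulo \<open>s\<close> the diagonal of \<open>M\<close> vanishes, its off-diagonal
  entries become 1 and -1, and conjugation disappears, so the new upper right entry is det g = 1.
  The other conditions follow from the shape of \<open>act\<close> and from multiplicativity of the
  determinant.\<close>

lemma act_walls:
  assumes g: "g \<in> SL" and M: "M \<in> walls"
  shows "act g M \<in> walls"
proof -
  obtain a b c e where g_eq: "g = mat2 a b c e" using mat2_eta by metis
  have g': "a \<in> O_d" "b \<in> O_d" "c \<in> O_d" "e \<in> O_d" and det: "a * e - b * c = 1" using g g_eq mat2_SL_iff by auto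
  obtain k l z m where M_eq: "M = mat2 (of_int k * s) z (- cnj z) (of_int l * s)"
    and z: "z = 1 + s * m" "m \<in> O_d" and zz: "z * cnj z = 1 - of_int (d * k * l)"
    using M unfolding walls_def by blast
  obtain m1 where m1: "m1 \<in> O_d" "cnj a = a + s * m1" using cnj_cong_s g' by metis
  obtain m2 where m2: "m2 \<in> O_d" "cnj c = c + s * m2" using cnj_cong_s g' by metis
  let ?A = "act g M"
  have A11: "?A$1$1 = of_int k * s * a * cnj a + z * cnj a * c - cnj z * a * cnj c + of_int l * s * c * cnj c"
    and A12: "?A$1$2 = of_int k * s * b * cnj a + z * cnj a * e - cnj z * b * cnj c + of_int l * s * e * cnj c"
    and A21: "?A$2$1 = of_int k * s * a * cnj b + z * cnj b * c - cnj z * a * cnj e + of_int l * s * c * cnj e"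
    and A22: "?A$2$2 = of_int k * s * b * cnj b + z * cnj b * e - cnj z * b * cnj e + of_int l * s * e * cnj e"
    by (simp_all add: act_def hadj_def M_eq g_eq mat2_mult algebra_simps)
  have zO: "z \<in> O_d" using z by auto
  have "?A$1$1 \<in> O_d" "?A$2$2 \<in> O_d" unfolding A11 A22 using g' zO by auto
  moreover have "cnj (?A$1$1) = - ?A$1$1" "cnj (?A$2$2) = - ?A$2$2" "?A$2$1 = - cnj (?A$1$2)"
    unfolding A11 A12 A21 A22 by (simp_all add: algebra_simps)
  moreover have "?A$1$2 = 1 + s * (of_int k * b * cnj a + m1 * e + m * cnj a * e - m2 * b + cnj m * b * cnj c + of_int l * e * cnj c)"
  proof -
    have "?A$1$2 = of_int k * s * b * cnj a + (1 + s * m) * cnj a * e - (1 - s * cnj m) * b * cnj c + of_int l * s * e * cnj c"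
      unfolding A12 z by simp
    also have "\<dots> = (cnj a * e - b * cnj c) + s * (of_int k * b * cnj a + m * cnj a * e + cnj m * b * cnj c + of_int l * e * cnj c)"
      by (simp add: algebra_simps)
    also have "cnj a * e - b * cnj c = (a * e - b * c) + s * (m1 * e - m2 * b)"
      unfolding m1(2) m2(2) by (simp add: algebra_simps)
    finally show ?thesis unfolding det by (simp add: algebra_simps)
  qed
  then have "\<exists>m\<in>O_d. ?A$1$2 = 1 + s * m" using g' z m1 m2 by blast
  moreover have "?A$1$1 * ?A$2$2 - ?A$1$2 * ?A$2$1 = 1"
  proof -
    have "det ?A = det (hadj g) * det M * det g" by (simp add: act_def det_mul)
    also have "det g = 1" using det by (simp add: g_eq det_mat2)
    also have "det (hadj g) = cnj (a * e - b * c)" by (simp add: g_eq hadj_def det_mat2 mult.commute)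
    also have "det M = 1" using M unfolding walls_iff det_2 by blast
    finally show ?thesis unfolding det by (simp add: det_2)
  qed
  ultimately show ?thesis unfolding walls_iff by blast
qed

lemma bij_betw_act:
  assumes "g \<in> SL" shows "bij_betw (act g) walls walls"
proof (rule bij_betw_byWitness[where f' = "act (adjugate g)"])
  show "\<forall>M\<in>walls. act (adjugate g) (act g M) = M" "\<forall>M\<in>walls. act g (act (adjugate g) M) = M"
    using assms by (simp_all flip: act_mult add: mult_adjugate adjugate_mult act_one)
qed (use act_walls adjugate_SL assms in auto)

text \<open>Squaring the bound \<open>S\<close> and using 4 p q |kl| <= (p |k| + q |l|)^2 with
  \<open>p q = 1 + R^2\<close>, the terms with R^2 |kl| cancel and leave \<sigma>^2 |kl| <= R^2.
  This bounds \<open>B\<close>, and then \<open>S\<close> bounds \<open>k\<close> and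
  \<open>l\<close> separately.\<close>

lemma flip_bounds:
  fixes p q R D \<sigma> B :: real and k l :: int
  assumes pos: "p > 0" "q > 0" "R \<ge> 0" "\<sigma> > 0" "B \<ge> 0"
    and pq: "p * q = 1 + R\<^sup>2" and B: "B\<^sup>2 = 1 + \<sigma>\<^sup>2 * of_int (k * l)" and kl: "k * l \<ge> 0"
    and S: "\<sigma> * (p * of_int \<bar>k\<bar> + q * of_int \<bar>l\<bar>) \<le> 2 * B * R"
  shows "B \<le> 1 + R" "of_int \<bar>k\<bar> \<le> 2 * (1 + R) * R / \<sigma> / p" "of_int \<bar>l\<bar> \<le> 2 * (1 + R) * R / \<sigma> / q"
proof -
  define x where "x = real_of_int \<bar>k\<bar>"
  define y where "y = real_of_int \<bar>l\<bar>"
  have xy: "x \<ge> 0" "y \<ge> 0" "x * y = of_int (k * l)"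
    using kl by (simp_all add: x_def y_def flip: abs_mult of_int_mult)
  have "(\<sigma> * (p * x + q * y))\<^sup>2 \<le> (2 * B * R)\<^sup>2"
    using S pos xy by (intro power_mono) (auto simp: x_def y_def)
  then have "\<sigma>\<^sup>2 * (p * x + q * y)\<^sup>2 \<le> 4 * R\<^sup>2 * (1 + \<sigma>\<^sup>2 * (x * y))"
    using B xy by (simp add: power_mult_distrib mult_ac)
  moreover have "4 * (p * q) * (x * y) \<le> (p * x + q * y)\<^sup>2"
    using zero_le_power2[of "p * x - q * y"] by (simp add: power2_eq_square algebra_simps)
  then have "\<sigma>\<^sup>2 * (4 * (1 + R\<^sup>2) * (x * y)) \<le> \<sigma>\<^sup>2 * (p * x + q * y)\<^sup>2"
    unfolding pq by (intro mult_left_mono) auto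
  ultimately have "\<sigma>\<^sup>2 * (x * y) \<le> R\<^sup>2" by (simp add: algebra_simps)
  then have "B\<^sup>2 \<le> 1 + R\<^sup>2" using B xy by simp
  also have "\<dots> \<le> (1 + R)\<^sup>2" using pos by (simp add: power2_eq_square algebra_simps)
  finally show Bb: "B \<le> 1 + R" using pos by (simp add: power2_le_iff_abs_le)
  have "2 * B * R \<le> 2 * (1 + R) * R" using Bb pos by (intro mult_right_mono) auto
  then have "\<sigma> * (p * x + q * y) \<le> 2 * (1 + R) * R" using S by (simp add: x_def y_def)
  moreover have "p * x \<le> p * x + q * y" "q * y \<le> p * x + q * y" using pos xy by auto
  ultimately have "\<sigma> * (p * x) \<le> 2 * (1 + R) * R" "\<sigma> * (q * y) \<le> 2 * (1 + R) * R"
    using pos by (meson mult_left_mono order_trans less_imp_le)+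
  then show "of_int \<bar>k\<bar> \<le> 2 * (1 + R) * R / \<sigma> / p" "of_int \<bar>l\<bar> \<le> 2 * (1 + R) * R / \<sigma> / q"
    using pos by (simp_all add: x_def y_def field_simps)
qed

lemma pos_side_mat2: "pos_side (mat2 (of_int k * s) z z' (of_int l * s)) \<longleftrightarrow> k + l < 0"
proof -
  have "Im (of_int k * s + of_int l * s) = of_int (k + l) * Im s" by (simp add: algebra_simps)
  then show ?thesis using Im_s_pos by (simp only: pos_side_def mat2_nth mult_less_0_iff) auto
qed

lemma walls_norm:
  assumes "b * cnj b = 1 - of_int (d * k * l)"
  shows "(cmod b)\<^sup>2 = 1 + (Im s)\<^sup>2 * of_int (k * l)"
proof -
  have "of_real ((cmod b)\<^sup>2) = b * cnj b" by (simp only: complex_norm_square)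
  also have "\<dots> = of_real (1 - of_int (d * k * l))" unfolding assms by simp
  finally have "(cmod b)\<^sup>2 = 1 - of_int (d * k * l)" by (simp only: of_real_eq_iff)
  then show ?thesis using Im_s_squared by (simp add: power2_eq_square)
qed

text \<open>Otherwise the squared modulus of \<open>b\<close> would be at most 1 + d < 0.
  Geometrically, \<open>j\<close> lies outside every hemisphere of the family.\<close>

lemma walls_sign:
  assumes "b * cnj b = 1 - of_int (d * k * l)" "d < -1"
  shows "k * l \<ge> 0"
proof (rule ccontr)
  assume "\<not> k * l \<ge> 0"
  then have "(- d) * (k * l) \<le> (- d) * (- 1)" using d_neg by (intro mult_left_mono) auto
  then have "d * (k * l) \<ge> - d" by simp
  then have "d * k * l > 1" using assms(2) by (simp add: mult.assoc)
  then have "real_of_int (1 - d * k * l) < 0" by linarith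
  moreover have "(cmod b)\<^sup>2 = of_int (1 - d * k * l)"
    using walls_norm[OF assms(1)] Im_s_squared by (simp add: power2_eq_square)
  ultimately show False by (metis not_less zero_le_power2)
qed

lemma finite_flips:
  assumes g: "g \<in> SL" and "d < -1"
  shows "finite (flips g)"
proof -
  obtain a b c e where g_eq: "g = mat2 a b c e" using mat2_eta by metis
  have det: "a * e - b * c = 1" using g g_eq mat2_SL_iff by auto
  \<comment> \<open>\<open>p\<close>, \<open>q\<close>, \<open>r\<close> are the entries of
    \<open>g\<close> times its conjugate transpose, which represents the point g j;
    \<open>pq\<close> says that its determinant is 1.\<close>
  define p where "p = (cmod a)\<^sup>2 + (cmod b)\<^sup>2"
  define q where "q = (cmod c)\<^sup>2 + (cmod e)\<^sup>2"
  define r where "r = a * cnj c + b * cnj e"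
  define R where "R = cmod r"
  have pc: "of_real p = a * cnj a + b * cnj b" "of_real q = c * cnj c + e * cnj e"
    by (simp_all add: p_def q_def flip: complex_norm_square)
  have "of_real (p * q) = of_real (R\<^sup>2) + (a * e - b * c) * cnj (a * e - b * c)"
    unfolding of_real_mult pc R_def complex_norm_square r_def by (simp add: algebra_simps)
  also have "\<dots> = of_real (1 + R\<^sup>2)" unfolding det by simp
  finally have pq: "p * q = 1 + R\<^sup>2" by (simp only: of_real_eq_iff)
  have "p \<ge> 0" "q \<ge> 0" by (auto simp: p_def q_def)
  moreover have "p * q > 0" unfolding pq by (simp add: add_pos_nonneg)
  ultimately have pos: "p > 0" "q > 0" by (auto simp: zero_less_mult_iff)
  define K where "K = \<lceil>2 * (1 + R) * R / Im s / p\<rceil>"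
  define L where "L = \<lceil>2 * (1 + R) * R / Im s / q\<rceil>"
  let ?f = "\<lambda>(k, l, z). mat2 (of_int k * s) z (- cnj z) (of_int l * s)"
  have "flips g \<subseteq> ?f ` ({- K..K} \<times> {- L..L} \<times> {z \<in> O_d. cmod z \<le> 1 + R})"
  proof
    fix M assume M: "M \<in> flips g"
    then obtain k l z where M_eq: "M = mat2 (of_int k * s) z (- cnj z) (of_int l * s)" and z: "z \<in> O_d"
      and zz: "z * cnj z = 1 - of_int (d * k * l)"
      unfolding flips_def walls_def by blast
    have kl: "k * l \<ge> 0" using walls_sign[OF zz \<open>d < -1\<close>] .
    have "act g M $ 1 $ 1 + act g M $ 2 $ 2 = s * (of_int k * of_real p + of_int l * of_real q) + (z * cnj r - cnj (z * cnj r))"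
      unfolding pc r_def by (simp add: act_def hadj_def M_eq g_eq mat2_mult algebra_simps)
    then have tr: "Im (act g M $ 1 $ 1 + act g M $ 2 $ 2) = Im s * (of_int k * p + of_int l * q) + 2 * Im (z * cnj r)"
      by simp
    have 1: "pos_side M \<longleftrightarrow> k + l < 0" unfolding M_eq by (rule pos_side_mat2)
    have 2: "pos_side (act g M) \<longleftrightarrow> Im s * (of_int k * p + of_int l * q) + 2 * Im (z * cnj r) < 0"
      unfolding pos_side_def tr ..
    have Imr: "\<bar>Im (z * cnj r)\<bar> \<le> cmod z * R"
      using abs_Im_le_cmod[of "z * cnj r"] by (simp add: R_def norm_mult)
    \<comment> \<open>As \<open>k\<close> and \<open>l\<close> have no opposite signs, the diagonal
      terms all push the trace to the side of \<open>M\<close>; only the mixed term, of size at most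
      \<open>2 * cmod z * R\<close>, can change the side.\<close>
    have "Im s * (p * of_int \<bar>k\<bar> + q * of_int \<bar>l\<bar>) \<le> 2 * cmod z * R"
    proof (cases "k + l < 0")
      case True
      then have "k \<le> 0" "l \<le> 0" using kl by (auto simp: zero_le_mult_iff)
      moreover have "Im s * (of_int k * p + of_int l * q) + 2 * Im (z * cnj r) \<ge> 0"
        using True 1 2 M unfolding flips_def by auto
      ultimately show ?thesis using Imr by (simp add: algebra_simps)
    next
      case False
      then have "k \<ge> 0" "l \<ge> 0" using kl by (auto simp: zero_le_mult_iff)
      moreover have "Im s * (of_int k * p + of_int l * q) + 2 * Im (z * cnj r) < 0"
        using False 1 2 M unfolding flips_def by auto
      ultimately show ?thesis using Imr by (simp add: algebra_simps)
    qed
    from flip_bounds[OF pos _ Im_s_pos _ pq walls_norm[OF zz] kl this]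
    have "cmod z \<le> 1 + R" "of_int \<bar>k\<bar> \<le> 2 * (1 + R) * R / Im s / p" "of_int \<bar>l\<bar> \<le> 2 * (1 + R) * R / Im s / q"
      by (simp_all add: R_def)
    then have "cmod z \<le> 1 + R" "\<bar>k\<bar> \<le> K" "\<bar>l\<bar> \<le> L" unfolding K_def L_def by linarith+
    then have "(k, l, z) \<in> {- K..K} \<times> {- L..L} \<times> {z \<in> O_d. cmod z \<le> 1 + R}" using z by auto
    then show "M \<in> ?f ` ({- K..K} \<times> {- L..L} \<times> {z \<in> O_d. cmod z \<le> 1 + R})"
      unfolding M_eq by (intro image_eqI[where x = "(k, l, z)"]) auto
  qed
  then show ?thesis by (rule finite_subset) (intro finite_imageI finite_cartesian_product finite_atLeastAtMost_int finite_O_bounded)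
qed

text \<open>A plane is flipped by \<open>g ** h\<close> iff exactly one of two things happens:
  \<open>g\<close> flips it, or \<open>h\<close> flips its image under \<open>act g\<close>. So the
  flips form a symmetric difference, and \<open>act g\<close> being a bijection of the planes makes
  the second set equinumerous with \<open>flips h\<close>.\<close>

lemma even_card_flips_mult:
  assumes "g \<in> SL" "h \<in> SL" "d < -1"
  shows "even (card (flips (g ** h))) \<longleftrightarrow> even (card (flips g)) = even (card (flips h))"
proof -
  define P where "P = {M \<in> walls. act g M \<in> flips h}"
  have "bij_betw (act g) P (flips h)"
    unfolding P_def using bij_betw_act[OF assms(1)]
    by (auto simp: bij_betw_def inj_on_def flips_def image_iff)
  then have P: "finite P" "card P = card (flips h)"
    using finite_flips[OF assms(2,3)] bij_betw_finite bij_betw_same_card by blast+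
  have "flips (g ** h) = (flips g - P) \<union> (P - flips g)"
    using act_walls[OF assms(1)] by (auto simp: flips_def P_def act_mult)
  then show ?thesis
    using even_card_symmetric_difference[OF finite_flips[OF assms(1,3)] P(1)] P(2) by simp
qed

lemma flips_translation_w:
  assumes "d < -4"
  shows "flips (mat2 1 w 0 1) = {mat2 0 1 (-1) 0}"
proof -
  have E: "mat2 1 w 0 1 \<in> SL" by (simp add: mat2_SL_iff)
  have *: "M \<in> flips (mat2 1 w 0 1) \<longleftrightarrow> M = mat2 0 1 (-1) 0" if MW: "M \<in> walls" for M
  proof -
    obtain k l z where M_eq: "M = mat2 (of_int k * s) z (- cnj z) (of_int l * s)"
      and zm': "\<exists>m\<in>O_d. z = 1 + s * m" and zz: "z * cnj z = 1 - of_int (d * k * l)"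
      using MW unfolding walls_def by blast
    obtain m where zm: "z = 1 + s * m" "m \<in> O_d" using zm' by blast
    obtain k' l' z' where A_eq: "act (mat2 1 w 0 1) M = mat2 (of_int k' * s) z' (- cnj z') (of_int l' * s)"
      and zz': "z' * cnj z' = 1 - of_int (d * k' * l')"
      using act_walls[OF E MW] unfolding walls_def by blast
    have "act (mat2 1 w 0 1) M $ 1 $ 1 = of_int k * s"
      by (simp add: act_def hadj_def M_eq mat2_mult)
    then have k': "k' = k" unfolding A_eq by simp
    have kl: "k * l \<ge> 0" "k * l' \<ge> 0"
      using walls_sign[OF zz] walls_sign[OF zz'] k' assms by auto
    have fl: "M \<in> flips (mat2 1 w 0 1) \<longleftrightarrow> (k + l < 0) \<noteq> (k + l' < 0)"
      using MW unfolding flips_def by (simp add: M_eq[symmetric] A_eq pos_side_mat2 k') (simp add: M_eq pos_side_mat2)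
    show ?thesis
    proof (cases "k = 0")
      case False
      \<comment> \<open>For a hemisphere neither \<open>l\<close> nor \<open>l'\<close> has the sign
        opposite to \<open>k\<close>, so \<open>k\<close> decides both sides.\<close>
      then have "(k + l < 0) = (k + l' < 0)" using kl by (auto simp: zero_le_mult_iff)
      moreover have "M \<noteq> mat2 0 1 (-1) 0" using False by (simp add: M_eq matrix_2_eq_iff)
      ultimately show ?thesis using fl by simp
    next
      case True
      have "(cmod z)\<^sup>2 = 1\<^sup>2" using walls_norm[OF zz] True by simp
      then have z1: "cmod z = 1" by (rule power2_eq_imp_eq) auto
      obtain x y where xy: "m = of_int x + of_int y * w" using zm(2) O_iff by auto
      have "s * m = of_int x * s + of_int y * (s + s * s) / 2" by (simp add: xy w_def algebra_simps)
      then have "Re (s * m) = of_int (y * d) / 2" unfolding s_squared by simp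
      then have Rez: "Re z = 1 + of_int (y * d) / 2" by (simp add: zm)
      have "\<bar>Re z\<bar> \<le> 1" using z1 abs_Re_le_cmod by metis
      then have "y * d \<ge> -4" "y * d \<le> 0" unfolding Rez by linarith+
      \<comment> \<open>Here \<open>z\<close> has modulus 1, so its real part 1 + y d / 2 lies
        between -1 and 1. For \<open>d < -4\<close> this leaves only \<open>y = 0\<close>, hence
        \<open>z = 1\<close>.\<close>
      have "y = 0"
      proof (rule ccontr)
        assume "y \<noteq> 0"
        then have "y \<ge> 1" using \<open>y * d \<le> 0\<close> assms by (auto simp: mult_le_0_iff)
        then have "y * (- d) \<ge> 1 * (- d)" using assms by (intro mult_right_mono) auto
        then show False using \<open>y * d \<ge> -4\<close> assms unfolding mult_minus_right by linarith
      qed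
      then have "Re z = 1" using Rez by simp
      then have "Im z = 0" using z1 by (simp add: cmod_def)
      then have z_1: "z = 1" using \<open>Re z = 1\<close> by (simp add: complex_eq_iff)
      have "act (mat2 1 w 0 1) M $ 2 $ 2 = cnj w - w + of_int l * s"
        by (simp add: act_def hadj_def M_eq mat2_mult True z_1)
      also have "\<dots> = of_int (l - 1) * s" unfolding cnj_w by (simp add: s_eq_w algebra_simps)
      \<comment> \<open>The sign of the trace therefore changes only at \<open>l = 0\<close>, the
        plane Im z = 0 through \<open>j\<close> itself.\<close>
      finally have "l' = l - 1" unfolding A_eq by (simp only: mat2_nth mult_cancel_right s_nonzero of_int_eq_iff) simp
      moreover have "M = mat2 0 1 (-1) 0 \<longleftrightarrow> l = 0" by (simp add: M_eq matrix_2_eq_iff True z_1)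
      ultimately show ?thesis using fl True by auto
    qed
  qed
  moreover have "mat2 0 1 (-1) 0 \<in> walls" unfolding walls_iff by (auto intro!: bexI[of _ 0])
  ultimately show ?thesis by (auto simp: flips_def)
qed

section \<open>Congruence subgroups have odd elements\<close>

abbreviation upper :: "complex \<Rightarrow> complex^2^2" where "upper x \<equiv> mat2 1 x 0 1"

lemma upper_SL [simp, intro]: "x \<in> O_d \<Longrightarrow> upper x \<in> SL"
  by (simp add: mat2_SL_iff)

lemma upper_mult: "upper x ** upper y = upper (x + y)"
  by (simp add: mat2_mult add.commute)

lemma upper_0: "upper 0 = mat 1" by (simp add: matrix_2_eq_iff)

definition even_flips :: "complex^2^2 \<Rightarrow> bool" where
  "even_flips A \<longleftrightarrow> even (card (flips A))"

lemma even_flips_one: "even_flips (mat 1)"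
  by (simp add: even_flips_def flips_def act_one)

lemma even_flips_minus: "even_flips (- A) \<longleftrightarrow> even_flips A"
proof -
  have "act (- A) M = act A M" for M
    using act_mult[of "- mat 1" A M] by (simp add: minus_one_mult act_minus_one)
  then show ?thesis by (simp add: even_flips_def flips_def)
qed

context
  assumes d_less: "d < -4"
begin

lemma even_flips_mult:
  "A \<in> SL \<Longrightarrow> B \<in> SL \<Longrightarrow> even_flips (A ** B) \<longleftrightarrow> even_flips A = even_flips B"
  unfolding even_flips_def using even_card_flips_mult d_less by simp

lemma even_flips_adjugate: "A \<in> SL \<Longrightarrow> even_flips (adjugate A) \<longleftrightarrow> even_flips A"
  using even_flips_mult[of A "adjugate A"] mult_adjugate[of A] adjugate_SL even_flips_one by auto

text \<open>The translation by \<open>2 j w\<close> is a square and hence even, so the parity is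
  that of the translation by \<open>w\<close>, which crosses one plane.\<close>

lemma odd_multiple_not_even_flips:
  assumes "odd k" shows "\<not> even_flips (upper (of_int k * w))"
proof -
  obtain j where k: "k = 2 * j + 1" using assms by (auto elim: oddE)
  let ?J = "upper (of_int j * w)"
  have "upper (of_int k * w) = (?J ** ?J) ** upper w"
    by (simp add: upper_mult k algebra_simps)
  then have "even_flips (upper (of_int k * w)) \<longleftrightarrow> even_flips (upper w)"
    by (simp add: even_flips_mult)
  then show ?thesis using flips_translation_w[OF d_less] by (simp add: even_flips_def)
qed

lemma not_all_principal_congruence_even_flips:
  assumes d8: "d mod 8 = 5" and n: "n \<noteq> 0"
    and ev: "\<And>a b c e. \<lbrakk>a \<in> O_d; b \<in> O_d; c \<in> O_d; e \<in> O_d;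
      mat2 (1 + of_int n * a) (of_int n * b) (of_int n * c) (1 + of_int n * e) \<in> SL\<rbrakk> \<Longrightarrow>
      even_flips (mat2 (1 + of_int n * a) (of_int n * b) (of_int n * c) (1 + of_int n * e))"
  shows False
proof -
  obtain t m where nt: "n = 2 ^ t * m" and m: "odd m"
    using multiplicity_decompose'[of n 2] n by (metis odd_one)
  have N: "odd N" using d8 d_eq by presburger
  have "coprime N (2 ^ t)" using N by (simp add: coprime_commute)
  \<comment> \<open>\<open>N'\<close> inverts the norm of \<open>w\<close> modulo 2^t, so
    \<open>u\<close> below inverts \<open>w\<close> modulo 2^t.\<close>
  then obtain N' v where bez: "N' * N + v * 2 ^ t = 1"
    using bezout_int[of N "2 ^ t"] by auto
  define \<kappa> :: complex where "\<kappa> = of_int (v * 2 ^ t)"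
  \<comment> \<open>The factor \<open>1 + \<kappa>\<close> does not change \<open>w\<close> modulo
    2^t, and it turns \<open>a * u\<close> into exactly \<open>1 - \<kappa> * \<kappa>\<close>,
    which off-diagonal entries \<open>- \<kappa>\<close> and \<open>\<kappa>\<close> complete to
    determinant 1.\<close>
  define a where "a = w * (1 + \<kappa>)"
  define u where "u = of_int N' * cnj w"
  have "\<kappa> \<in> O_d" unfolding \<kappa>_def by (rule O_of_int)
  then have kO: "\<kappa> \<in> O_d" "a \<in> O_d" "u \<in> O_d" by (auto simp: a_def u_def)
  have ww: "w * cnj w = of_int N" unfolding cnj_w using w_squared by (simp add: algebra_simps)
  have "a * u = of_int (N' * N) * (1 + \<kappa>)"
    using ww by (simp add: a_def u_def algebra_simps)
  also have "N' * N = 1 - v * 2 ^ t" using bez by simp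
  also have "of_int (1 - v * 2 ^ t) = 1 - \<kappa>" by (simp add: \<kappa>_def)
  finally have au: "a * u = 1 - \<kappa> * \<kappa>" by (simp add: algebra_simps)
  \<comment> \<open>modulo \<open>2^t\<close> this is \<open>diag(\<omega>, \<omega>\<^sup>-\<^sup>1)\<close>, lifted to determinant 1 by Whitehead's trick\<close>
  define g where "g = mat2 a (- \<kappa>) \<kappa> u"
  have g: "g \<in> SL" using kO au by (simp add: g_def mat2_SL_iff)
  have main: "even_flips (upper ((1 - w * w) * (of_int m * y)))" if y: "y \<in> O_d" for y
  proof -
    define x where "x = of_int m * y"
    have x: "x \<in> O_d" using y by (simp add: x_def)
    \<comment> \<open>\<open>\<kappa>\<close> supplies the factor 2^t and \<open>x\<close> the
      factor \<open>m\<close>, so every term containing \<open>\<kappa> * x\<close> vanishes modulo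
      \<open>n\<close>.\<close>
    have kx: "\<kappa> * x = of_int n * (of_int v * y)" by (simp add: \<kappa>_def x_def nt)
    let ?C = "g ** upper x ** adjugate g"
    have C: "?C = mat2 (1 - a * (\<kappa> * x)) (a * a * x) (- \<kappa> * (\<kappa> * x)) (1 + a * (\<kappa> * x))"
      using au by (simp add: g_def adjugate_def mat2_mult) (simp add: matrix_2_eq_iff algebra_simps)
    \<comment> \<open>This translation cancels \<open>a * a * x\<close>, which is
      \<open>w * w * x\<close> modulo \<open>n\<close>, so \<open>?D\<close> is the identity modulo
      \<open>n\<close>.\<close>
    let ?D = "?C ** upper (- (w * w * x))"
    let ?r = "of_int v * y"
    let ?b = "?r * (w * w * (2 + \<kappa>) + a * w * w * x)"
    have "?D = mat2 (1 - a * (\<kappa> * x)) (\<kappa> * x * (w * w * (2 + \<kappa>) + a * w * w * x))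
        (- \<kappa> * (\<kappa> * x)) (1 + \<kappa> * x * (\<kappa> * w * w * x + a))"
      unfolding C mat2_mult by (simp add: matrix_2_eq_iff) (simp add: a_def algebra_simps)
    also have "\<dots> = mat2 (1 + of_int n * (- a * ?r)) (of_int n * ?b) (of_int n * (- \<kappa> * ?r))
       (1 + of_int n * (?r * (\<kappa> * w * w * x + a)))"
      unfolding kx by (simp add: matrix_2_eq_iff algebra_simps)
    finally have D: "?D = \<dots>" .
    have "?D \<in> SL" using g x adjugate_SL by auto
    then have "even_flips ?D" unfolding D using x y kO by (intro ev) auto
    then have "even_flips (upper x) = even_flips (upper (- (w * w * x)))"
      using g x adjugate_SL[OF g] by (auto simp: even_flips_mult even_flips_adjugate)
    then have "even_flips (upper x ** upper (- (w * w * x)))"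
      using x by (subst even_flips_mult) auto
    then show ?thesis by (simp add: upper_mult x_def algebra_simps)
  qed
  \<comment> \<open>The norm N (N + 2) is odd. Taking \<open>y\<close> to be the conjugate of
    \<open>1 - w * w\<close> times \<open>w\<close> in \<open>main\<close> then gives an odd
    multiple of \<open>w\<close>.\<close>
  have "(1 - w * w) * cnj (1 - w * w) = of_int (N\<^sup>2 + 2 * N)"
  proof -
    have "(1 - w * w) * cnj (1 - w * w) = (of_int (1 + N) - w) * (of_int (1 + N) - cnj w)"
    proof -
      have "1 - w * w = of_int (1 + N) - w" using w_squared by simp
      then show ?thesis by (simp only: complex_cnj_diff complex_cnj_of_int)
    qed
    also have "\<dots> = of_int ((1 + N)\<^sup>2) - of_int (1 + N) * (w + cnj w) + w * cnj w"
      by (simp add: algebra_simps power2_eq_square)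
    also have "\<dots> = of_int (N\<^sup>2 + 2 * N)"
      unfolding ww by (simp add: cnj_w algebra_simps power2_eq_square)
    finally show ?thesis .
  qed
  moreover have "(1 - w * w) * (of_int m * (cnj (1 - w * w) * w)) =
      of_int m * ((1 - w * w) * cnj (1 - w * w)) * w"
    by (simp only: mult_ac)
  ultimately have "(1 - w * w) * (of_int m * (cnj (1 - w * w) * w)) = of_int (m * (N\<^sup>2 + 2 * N)) * w"
    by (simp only: of_int_mult)
  then have "even_flips (upper (of_int (m * (N\<^sup>2 + 2 * N)) * w))"
    using main[of "cnj (1 - w * w) * w"] by (simp only: O_mult O_cnj O_diff O_1 O_w)
  moreover have "odd (m * (N\<^sup>2 + 2 * N))" using m N by simp
  ultimately show False using odd_multiple_not_even_flips by blast
qed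

section \<open>The subgroup of even elements of the Bianchi group\<close>

definition even_classes :: "(complex^2^2) set set" where
  "even_classes = cls ` {A \<in> SL. even_flips A}"

lemma cls_in_even_classes:
  assumes "A \<in> SL" shows "cls A \<in> even_classes \<longleftrightarrow> even_flips A"
  using assms unfolding even_classes_def
  by (auto simp: cls_eq doubleton_eq_iff even_flips_minus image_iff)

lemma subgroup_even_classes: "subgroup even_classes (bianchi_group d)"
proof (rule PSL.subgroupI)
  show "even_classes \<subseteq> carrier (bianchi_group d)" by (auto simp: even_classes_def)
  show "even_classes \<noteq> {}" using even_flips_one SL_one by (auto simp: even_classes_def)
next
  fix x assume "x \<in> even_classes"
  then obtain A where A: "A \<in> SL" "even_flips A" "x = cls A" by (auto simp: even_classes_def)
  then have "inv\<^bsub>bianchi_group d\<^esub> x = cls (adjugate A)" by (simp flip: cls.hom_inv add: inv_SL)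
  then show "inv\<^bsub>bianchi_group d\<^esub> x \<in> even_classes"
    using A by (simp add: cls_in_even_classes adjugate_SL even_flips_adjugate)
next
  fix x y assume "x \<in> even_classes" "y \<in> even_classes"
  then obtain A B where AB: "A \<in> SL" "even_flips A" "x = cls A" "B \<in> SL" "even_flips B" "y = cls B"
    by (auto simp: even_classes_def)
  then have "x \<otimes>\<^bsub>bianchi_group d\<^esub> y = cls (A ** B)" using cls.hom_mult by simp
  then show "x \<otimes>\<^bsub>bianchi_group d\<^esub> y \<in> even_classes"
    using AB by (simp add: cls_in_even_classes even_flips_mult)
qed

lemma square_subgroup_even: "square_subgroup d \<subseteq> even_classes"
  unfolding square_subgroup_def
proof (rule PSL.generate_subgroup_incl[OF _ subgroup_even_classes], clarify)
  fix x assume "x \<in> carrier (bianchi_group d)"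
  then obtain A where A: "A \<in> SL" "x = cls A" using carrier_bianchi by auto
  then have "x [^]\<^bsub>bianchi_group d\<^esub> (2::nat) = cls (A ** A)"
    using cls.hom_mult[of A A] by (simp add: numeral_2_eq_2 PSL.nat_pow_Suc)
  then show "x [^]\<^bsub>bianchi_group d\<^esub> (2::nat) \<in> even_classes"
    using A by (simp add: cls_in_even_classes even_flips_mult)
qed

text \<open>A nonzero ideal contains the norm \<open>n\<close> of any of its nonzero elements, hence
  all multiples of the integer \<open>n\<close>, and the matrix statement for \<open>n\<close>
  applies.\<close>

lemma no_congruence_in_even_classes:
  assumes "d mod 8 = 5" "ideal \<pi> (ring_of_integers d)" "\<pi> \<noteq> {0}"
  shows "\<not> principal_congruence_subgroup d \<pi> \<subseteq> even_classes"
proof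
  assume sub: "principal_congruence_subgroup d \<pi> \<subseteq> even_classes"
  interpret ideal \<pi> "ring_of_integers d" by fact
  have O: "\<pi> \<subseteq> O_d" using a_subset carrier_ring_of_integers by simp
  have closed: "x * z \<in> \<pi>" if "x \<in> O_d" "z \<in> \<pi>" for x z
    using I_l_closed[OF that(2)] that(1) by (simp add: carrier_ring_of_integers) (simp add: ring_of_integers_def)
  have "0 \<in> \<pi>" using additive_subgroup.zero_closed[OF ideal.axioms(1)[OF assms(2)]]
    by (simp add: ring_of_integers_def)
  then obtain z where z: "z \<in> \<pi>" "z \<noteq> 0" using assms(3) by blast
  then obtain x y where xy: "z = of_int x + of_int y * w" using O O_iff by blast
  define n where "n = x\<^sup>2 + x * y + N * y\<^sup>2"
  have ww: "w * cnj w = of_int N" unfolding cnj_w using w_squared by (simp add: algebra_simps)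
  have "cnj z * z = of_int (x\<^sup>2) + of_int (x * y) * (w + cnj w) + of_int (y\<^sup>2) * (w * cnj w)"
    by (simp add: xy algebra_simps power2_eq_square)
  also have "\<dots> = of_int n" unfolding ww by (simp add: cnj_w n_def algebra_simps)
  finally have nz: "of_int n = cnj z * z" ..
  have n0: "n \<noteq> 0" using nz z(2) by auto
  have n\<pi>: "of_int n * t \<in> \<pi>" if "t \<in> O_d" for t
    using closed[of "t * cnj z" z] that z O nz by (auto simp: mult_ac)
  show False
  proof (rule not_all_principal_congruence_even_flips[OF assms(1) n0])
    fix a b c e assume h: "a \<in> O_d" "b \<in> O_d" "c \<in> O_d" "e \<in> O_d"
      "mat2 (1 + of_int n * a) (of_int n * b) (of_int n * c) (1 + of_int n * e) \<in> SL" (is "?A \<in> _")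
    have "matrix_cong \<pi> ?A (mat 1)" using h n\<pi> by (simp add: matrix_cong_def forall_2)
    then have "cls ?A \<in> principal_congruence_subgroup d \<pi>"
      using cls_in_bianchi[OF h(5)] cls_eq[of ?A] unfolding principal_congruence_subgroup_def by auto
    then show "even_flips ?A" using sub cls_in_even_classes[OF h(5)] by blast
  qed
qed

end

section \<open>The Eisenstein case\<close>

lemma cring_ring_of_integers: "cring (ring_of_integers d)"
proof (rule cringI)
  show "abelian_group (ring_of_integers d)"
    by (rule abelian_groupI; unfold carrier_ring_of_integers; simp add: ring_of_integers_def add_ac)
       (rule_tac x = "- x" in bexI, simp_all)
  show "comm_monoid (ring_of_integers d)"
    by (rule comm_monoidI; unfold carrier_ring_of_integers; simp add: ring_of_integers_def mult_ac)
qed (unfold carrier_ring_of_integers, simp add: ring_of_integers_def distrib_right)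

text \<open>The commutator of x and y is x^2 (x^-1 y)^2 y^-2. Thus congruence needs proof only for
  the commutator subgroup, and non-congruence only for the square subgroup.\<close>

lemma commutator_subgroup_le_square_subgroup: "commutator_subgroup d \<subseteq> square_subgroup d"
proof -
  let ?B = "bianchi_group d"
  have sq: "subgroup (square_subgroup d) ?B"
    unfolding square_subgroup_def by (rule PSL.generate_is_subgroup) auto
  have gen: "x \<otimes>\<^bsub>?B\<^esub> x \<in> square_subgroup d" if "x \<in> carrier ?B" for x
    unfolding square_subgroup_def using that
    by (intro generate.incl) (auto simp: numeral_2_eq_2 PSL.nat_pow_Suc intro!: exI[of _ x])
  show ?thesis unfolding commutator_subgroup_def derived_def
  proof (rule PSL.generate_subgroup_incl[OF _ sq], clarify)
    fix x y assume x: "x \<in> carrier ?B" and y: "y \<in> carrier ?B"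
    let ?x = "inv\<^bsub>?B\<^esub> x" and ?y = "inv\<^bsub>?B\<^esub> y"
    have "x \<otimes>\<^bsub>?B\<^esub> y \<otimes>\<^bsub>?B\<^esub> ?x \<otimes>\<^bsub>?B\<^esub> ?y =
      (x \<otimes>\<^bsub>?B\<^esub> x) \<otimes>\<^bsub>?B\<^esub> ((?x \<otimes>\<^bsub>?B\<^esub> y) \<otimes>\<^bsub>?B\<^esub> (?x \<otimes>\<^bsub>?B\<^esub> y)) \<otimes>\<^bsub>?B\<^esub> (?y \<otimes>\<^bsub>?B\<^esub> ?y)"
    proof -
      have "z \<otimes>\<^bsub>?B\<^esub> (inv\<^bsub>?B\<^esub> z \<otimes>\<^bsub>?B\<^esub> u) = u" if "z \<in> carrier ?B" "u \<in> carrier ?B" for z u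
        using that by (simp flip: PSL.m_assoc)
      then show ?thesis using x y by (simp add: PSL.m_assoc)
    qed
    then show "x \<otimes>\<^bsub>?B\<^esub> y \<otimes>\<^bsub>?B\<^esub> ?x \<otimes>\<^bsub>?B\<^esub> ?y \<in> square_subgroup d"
      using subgroup.m_closed[OF sq subgroup.m_closed[OF sq gen[OF x] gen[of "?x \<otimes>\<^bsub>?B\<^esub> y"]] gen[of ?y]] x y
      by (simp only: PSL.inv_closed PSL.m_closed)
  qed
qed

text \<open>The norm form takes integer values; this supplies the measure for the Euclidean
  descent.\<close>

lemma O_norm_nat:
  assumes "z \<in> O_d" shows "\<exists>n::nat. (cmod z)\<^sup>2 = real n"
proof -
  obtain x y where xy: "z = of_int x + of_int y * w" using assms O_iff by auto
  have "of_real ((cmod z)\<^sup>2) = z * cnj z" by (simp only: complex_norm_square)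
  also have "\<dots> = of_int (x\<^sup>2) + of_int (x * y) + of_int (y\<^sup>2) * (w - w * w)"
    by (simp add: xy cnj_w algebra_simps power2_eq_square)
  also have "\<dots> = of_real (of_int (x\<^sup>2 + x * y + y\<^sup>2 * N))" by (simp add: w_squared)
  finally have "(cmod z)\<^sup>2 = of_int (x\<^sup>2 + x * y + y\<^sup>2 * N)" by (simp only: of_real_eq_iff)
  moreover from this have "x\<^sup>2 + x * y + y\<^sup>2 * N \<ge> 0"
    by (metis of_int_0_le_iff zero_le_power2)
  ultimately show ?thesis by (metis nonneg_int_cases of_int_of_nat_eq)
qed

section \<open>Generators and the abelianization\<close>

definition S :: "complex^2^2" where "S = mat2 0 (-1) 1 0"

lemma S_SL [simp, intro]: "S \<in> SL" by (simp add: S_def mat2_SL_iff)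

lemma S_mult: "A ** S = mat2 (A$1$2) (- A$1$1) (A$2$2) (- A$2$1)"
  by (simp add: S_def matrix_2_eq_iff matrix_matrix_mult_2)

lemma mult_upper: "A ** upper x = mat2 (A$1$1) (x * A$1$1 + A$1$2) (A$2$1) (x * A$2$1 + A$2$2)"
  by (simp add: matrix_2_eq_iff matrix_matrix_mult_2 mult.commute)

definition abelianized :: "complex^2^2 \<Rightarrow> (complex^2^2) set set" where
  "abelianized A = commutator_subgroup d #>\<^bsub>bianchi_group d\<^esub> cls A"

definition Q where "Q = bianchi_group d Mod commutator_subgroup d"

sublocale Q: comm_group Q
  unfolding Q_def commutator_subgroup_def by (rule PSL.derived_quot_is_comm_group)

sublocale commutator: normal "commutator_subgroup d" "bianchi_group d"
  unfolding commutator_subgroup_def by (rule PSL.derived_self_is_normal)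

sublocale ab: group_hom "SL2 d" Q abelianized
proof (unfold_locales, rule homI)
  fix A B assume AB: "A \<in> carrier (SL2 d)" "B \<in> carrier (SL2 d)"
  then show "abelianized A \<in> carrier Q"
    by (auto simp: Q_def abelianized_def carrier_FactGroup)
  show "abelianized (A \<otimes>\<^bsub>SL2 d\<^esub> B) = abelianized A \<otimes>\<^bsub>Q\<^esub> abelianized B"
    using AB hom_mult[OF commutator.r_coset_hom_Mod, of "cls A" "cls B"] cls.hom_mult[of A B]
    by (simp add: Q_def abelianized_def)
qed

lemma abelianized_eq_one:
  assumes "A \<in> SL" "abelianized A = \<one>\<^bsub>Q\<^esub>" shows "cls A \<in> commutator_subgroup d"
  using assms PSL.rcos_self[OF _ commutator.subgroup_axioms, of "cls A"]
  by (auto simp: Q_def abelianized_def)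

lemma abelianized_mult: "A \<in> SL \<Longrightarrow> B \<in> SL \<Longrightarrow> abelianized (A ** B) = abelianized A \<otimes>\<^bsub>Q\<^esub> abelianized B"
  using ab.hom_mult by simp

lemma abelianized_conj:
  assumes "A \<in> SL" "B \<in> SL" shows "abelianized (A ** B ** adjugate A) = abelianized B"
proof -
  have "abelianized (A ** B ** adjugate A) = abelianized A \<otimes>\<^bsub>Q\<^esub> abelianized B \<otimes>\<^bsub>Q\<^esub> abelianized (adjugate A)"
    using assms adjugate_SL by (simp add: abelianized_mult)
  also have "\<dots> = abelianized B \<otimes>\<^bsub>Q\<^esub> (abelianized A \<otimes>\<^bsub>Q\<^esub> abelianized (adjugate A))"
    using assms adjugate_SL by (simp add: Q.m_ac)
  also have "abelianized A \<otimes>\<^bsub>Q\<^esub> abelianized (adjugate A) = \<one>\<^bsub>Q\<^esub>"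
    using assms adjugate_SL ab.hom_one by (simp flip: abelianized_mult add: mult_adjugate)
  finally show ?thesis using assms by simp
qed

definition ab_upper :: "complex \<Rightarrow> (complex^2^2) set set" where "ab_upper x = abelianized (upper x)"

lemma ab_upper_carrier [simp]: "x \<in> O_d \<Longrightarrow> ab_upper x \<in> carrier Q"
  using ab.hom_closed by (simp add: ab_upper_def)

lemma ab_upper_add: "x \<in> O_d \<Longrightarrow> y \<in> O_d \<Longrightarrow> ab_upper (x + y) = ab_upper x \<otimes>\<^bsub>Q\<^esub> ab_upper y"
  by (simp add: ab_upper_def abelianized_mult flip: upper_mult)

text \<open>
  On integral matrices of determinant 1 this is, modulo 3, the homomorphism from \<open>SL(2, \<int>)\<close>
  to \<open>\<int>/3\<close> that maps the translation by 1 to 1.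
\<close>

definition char3 :: "int \<Rightarrow> int \<Rightarrow> int \<Rightarrow> int \<Rightarrow> int" where
  "char3 i j k l = (1 - k\<^sup>2) * j * l + k * (i + l)"

text \<open>The error terms carry the factor \<open>k * (1 - k^2)\<close>, divisible by 3 by Fermat,
  or the factor \<open>i * l - j * k - 1\<close>, which is zero.\<close>

lemma char3_upper:
  assumes "i * l - j * k = 1"
  shows "\<exists>t. char3 i (x * i + j) k (x * k + l) = char3 i j k l + x + 3 * t"
proof -
  have "3 dvd k * (1 - k\<^sup>2)"
  proof -
    have "3 dvd k \<or> 3 dvd 1 - k \<or> 3 dvd 1 + k" by presburger
    moreover have "k * (1 - k\<^sup>2) = k * ((1 - k) * (1 + k))" by (simp add: power2_eq_square algebra_simps)
    ultimately show ?thesis by (metis dvd_mult dvd_mult2)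
  qed
  then obtain t where t: "k * (1 - k\<^sup>2) = 3 * t" by (auto elim: dvdE)
  have "char3 i (x * i + j) k (x * k + l) - char3 i j k l - x
    = k * (1 - k\<^sup>2) * (i * x\<^sup>2 + 2 * j * x) + (1 - k\<^sup>2) * x * (i * l - j * k - 1)"
    by (simp add: char3_def algebra_simps power2_eq_square)
  then show ?thesis unfolding t assms by (intro exI[of _ "t * (i * x\<^sup>2 + 2 * j * x)"]) simp
qed

lemma char3_S:
  assumes "i * l - j * k = 1"
  shows "char3 j (- i) l (- k) = char3 i j k l + 3 * (- k * l)"
proof -
  have "char3 j (- i) l (- k) - char3 i j k l = - (k * l) * (i * l - j * k) - 2 * k * l"
    by (simp add: char3_def algebra_simps power2_eq_square)
  then show ?thesis unfolding assms by simp
qed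

context
  assumes d3: "d = -3"
begin

lemma N_eq: "N = 1" using d_eq d3 by simp

lemma w_squared': "w * w = w - 1" using w_squared N_eq by simp

lemma w_squared_mult: "w * (w * z) = w * z - z"
  by (simp flip: mult.assoc add: w_squared' left_diff_distrib)

text \<open>Rounding first the coordinate along \<open>w\<close> and then the real one leaves an
  error of squared modulus at most 1/4 + 3/16 < 1.\<close>

lemma euclid:
  assumes "a \<in> O_d" "b \<in> O_d" "b \<noteq> 0"
  obtains q where "q \<in> O_d" "cmod (a - q * b) < cmod b"
proof -
  define z where "z = a / b"
  define y where "y = round (Im z / (Im s / 2))"
  define x where "x = round (Re z - of_int y / 2)"
  define q where "q = of_int x + of_int y * w"
  have q: "q \<in> O_d" unfolding q_def by (rule O_I) simp
  have "\<bar>Re (z - q)\<bar> \<le> 1/2"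
  proof -
    have "Re (z - q) = (Re z - of_int y / 2) - of_int x" by (simp add: q_def w_def)
    then show ?thesis using of_int_round_abs_le[of "Re z - of_int y / 2"]
      by (simp only: x_def abs_minus_commute)
  qed
  then have 1: "(Re (z - q))\<^sup>2 \<le> (1/2)\<^sup>2" by (metis abs_ge_zero power2_abs power_mono)
  have "Im (z - q) = (Im z / (Im s / 2) - of_int y) * (Im s / 2)"
    using Im_s_pos by (simp add: q_def w_def field_simps)
  then have "(Im (z - q))\<^sup>2 = (Im z / (Im s / 2) - of_int y)\<^sup>2 * (Im s / 2)\<^sup>2"
    by (simp only: power_mult_distrib)
  also have "(Im s / 2)\<^sup>2 = (Im s * Im s) / 4" by (simp add: power2_eq_square)
  also have "\<dots> = 3 / 4" using Im_s_squared d3 by simp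
  also have "(Im z / (Im s / 2) - of_int y)\<^sup>2 * (3/4) \<le> (1/2)\<^sup>2 * (3/4)"
  proof -
    have "\<bar>Im z / (Im s / 2) - of_int y\<bar> \<le> 1/2"
      unfolding y_def using of_int_round_abs_le[of "Im z / (Im s / 2)"] by (simp add: abs_minus_commute)
    then have "(Im z / (Im s / 2) - of_int y)\<^sup>2 \<le> (1/2)\<^sup>2" by (metis abs_ge_zero power2_abs power_mono)
    then show ?thesis by (intro mult_right_mono) auto
  qed
  finally have 2: "(Im (z - q))\<^sup>2 \<le> (1/2)\<^sup>2 * (3/4)" .
  have "(cmod (z - q))\<^sup>2 < 1\<^sup>2"
    unfolding cmod_power2 using add_mono[OF 1 2] by (simp add: power_divide)
  then have "cmod (z - q) < 1" by (rule power2_less_imp_less) simp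
  moreover have "a - q * b = (z - q) * b" using assms(3) by (simp add: z_def field_simps)
  ultimately have "cmod (a - q * b) < cmod b" using assms(3) by (simp add: norm_mult)
  then show thesis using q that by blast
qed

text \<open>The class of a translation thus depends only on its residue modulo \<open>s\<close>,
  that is, on an integer modulo 3.\<close>

lemma ab_upper_s_mult:
  assumes "x \<in> O_d" shows "ab_upper (s * x) = \<one>\<^bsub>Q\<^esub>"
proof -
  \<comment> \<open>conjugation by \<open>g\<close> multiplies translations by \<open>w\<^sup>2\<close>, and \<open>s\<close> is associated to \<open>w\<^sup>2 - 1\<close>\<close>
  define g where "g = mat2 w 0 0 (1 - w)"
  have g: "g \<in> SL" using w_squared' by (simp add: g_def mat2_SL_iff algebra_simps)
  have rot: "ab_upper (w * w * y) = ab_upper y" if "y \<in> O_d" for y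
  proof -
    have "g ** upper y ** adjugate g = upper (w * w * y)"
      by (simp add: g_def adjugate_def matrix_2_eq_iff matrix_matrix_mult_2 algebra_simps w_squared' w_squared_mult)
    then show ?thesis using abelianized_conj[OF g, of "upper y"] that by (simp add: ab_upper_def)
  qed
  \<comment> \<open>By w^3 = -1 and w^2 = w - 1, this choice gives w^2 y - y = (w + w^2) x = (2w -
    1) x = s x.\<close>
  define y where "y = - (w * w * x)"
  have y: "y \<in> O_d" using assms by (simp add: y_def)
  have "w * w * w = -1" unfolding w_squared' left_diff_distrib w_squared' by simp
  then have "w * w * (w * w) = - w" by (simp add: mult_ac)
  then have "s * x = w * w * y + (- y)"
    by (simp add: y_def s_eq_w w_squared' algebra_simps)
  then have "ab_upper (s * x) = ab_upper (w * w * y) \<otimes>\<^bsub>Q\<^esub> ab_upper (- y)" using y by (simp only: ab_upper_add O_mult O_w O_uminus)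
  also have "\<dots> = ab_upper (y + (- y))" using y by (simp only: rot ab_upper_add O_uminus)
  also have "\<dots> = \<one>\<^bsub>Q\<^esub>" using ab.hom_one by (simp add: ab_upper_def upper_0)
  finally show ?thesis .
qed

lemma ab_upper_cong:
  assumes "x \<in> O_d" "t \<in> O_d" shows "ab_upper (x + s * t) = ab_upper x"
  using assms by (simp add: ab_upper_add ab_upper_s_mult)

lemma three_eq: "(3 :: complex) = s * (- s)" using s_squared d3 by simp

lemma ab_upper_cong_3: "ab_upper (of_int (k + 3 * t)) = ab_upper (of_int k)"
proof -
  have "of_int (k + 3 * t) = of_int k + 3 * of_int t" by simp
  also have "\<dots> = of_int k + s * (- s * of_int t)" unfolding three_eq by (simp only: mult.assoc)
  finally have "of_int (k + 3 * t) = \<dots>" .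
  then show ?thesis by (simp only: ab_upper_cong O_of_int O_mult O_uminus O_s)
qed

text \<open>\<open>S\<close> is a product of two translations by -1 and a conjugate of a third, so
  its class is that of the translation by -3 = s^2.\<close>

lemma abelianized_S: "abelianized S = \<one>\<^bsub>Q\<^esub>"
proof -
  have "S = upper (-1) ** (S ** upper (-1) ** adjugate S) ** upper (-1)"
    by (simp add: S_def adjugate_def mat2_mult)
  also have "abelianized \<dots> = abelianized (upper (-1)) \<otimes>\<^bsub>Q\<^esub> abelianized (S ** upper (-1) ** adjugate S) \<otimes>\<^bsub>Q\<^esub> abelianized (upper (-1))"
    using adjugate_SL by (simp add: abelianized_mult)
  also have "\<dots> = ab_upper (-1 + -1 + -1)"
    by (subst abelianized_conj) (simp_all only: ab_upper_def[symmetric] ab_upper_add S_SL upper_SL O_add O_uminus O_1)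
  also have "-1 + -1 + -1 = s * s" using s_squared d3 by simp
  also have "ab_upper (s * s) = \<one>\<^bsub>Q\<^esub>" by (rule ab_upper_s_mult) simp
  finally show ?thesis .
qed

definition int_cong :: "complex \<Rightarrow> int \<Rightarrow> bool" where
  "int_cong a i \<longleftrightarrow> (\<exists>t\<in>O_d. a = of_int i + s * t)"

lemma int_cong_exists:
  assumes "a \<in> O_d" obtains i where "int_cong a i"
proof -
  obtain x y where xy: "a = of_int x + of_int y * w" using assms O_iff by auto
  have "a = of_int (x - y) + s * (of_int y * (1 - w))"
    by (simp add: xy s_eq_w algebra_simps w_squared' w_squared_mult)
  then have "int_cong a (x - y)" unfolding int_cong_def by (intro bexI) auto
  then show thesis by (rule that)
qed

lemma int_cong_of_int [simp]: "int_cong (of_int i) i"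
  by (auto simp: int_cong_def intro: bexI[of _ 0])
lemma int_cong_0 [simp]: "int_cong 0 0" and int_cong_1 [simp]: "int_cong 1 1"
  using int_cong_of_int[of 0] int_cong_of_int[of 1] by simp_all

lemma int_cong_add: "int_cong a i \<Longrightarrow> int_cong b j \<Longrightarrow> int_cong (a + b) (i + j)"
  unfolding int_cong_def by (clarify, rename_tac t u, rule_tac x = "t + u" in bexI) (auto simp: algebra_simps)

lemma int_cong_uminus: "int_cong a i \<Longrightarrow> int_cong (- a) (- i)"
  unfolding int_cong_def by (clarify, rename_tac t, rule_tac x = "- t" in bexI) (auto simp: algebra_simps)

lemma int_cong_mult: "int_cong a i \<Longrightarrow> int_cong b j \<Longrightarrow> int_cong (a * b) (i * j)"
  unfolding int_cong_def
  by (clarify, rename_tac t u, rule_tac x = "of_int i * u + of_int j * t + s * t * u" in bexI) (auto simp: algebra_simps)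

text \<open>Comparing coordinates in the basis 1, \<open>w\<close> shows that the multiples of
  \<open>s\<close> meet the integers in the multiples of 3.\<close>

lemma int_cong_0_imp_dvd: assumes "int_cong (s * t) i" "t \<in> O_d" shows "3 dvd i"
proof -
  obtain u where u: "u \<in> O_d" "s * t = of_int i + s * u" using assms by (auto simp: int_cong_def)
  obtain x y where xy: "t - u = of_int x + of_int y * w" using O_diff[OF assms(2) u(1)] O_iff by auto
  have "of_int i + of_int 0 * w = s * (t - u)" using u(2) by (simp add: algebra_simps)
  also have "\<dots> = of_int (- x - 2 * y) + of_int (2 * x + y) * w"
    by (simp add: xy s_eq_w algebra_simps w_squared' w_squared_mult)
  finally have "i = - x - 2 * y" "2 * x + y = 0" unfolding O_coords_unique by auto
  then show ?thesis by presburger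
qed

text \<open>The integer lifts of the residues must have determinant exactly 1, as the transformation
  rules for \<open>char3\<close> require.\<close>

definition good :: "complex^2^2 \<Rightarrow> bool" where
  "good A \<longleftrightarrow> A \<in> SL \<and> (\<exists>i j k l. i * l - j * k = 1 \<and>
     int_cong (A$1$1) i \<and> int_cong (A$1$2) j \<and> int_cong (A$2$1) k \<and> int_cong (A$2$2) l \<and>
     abelianized A = ab_upper (of_int (char3 i j k l)))"

lemma goodI:
  "\<lbrakk>A \<in> SL; i * l - j * k = 1; int_cong (A$1$1) i; int_cong (A$1$2) j; int_cong (A$2$1) k;
    int_cong (A$2$2) l; abelianized A = ab_upper (of_int (char3 i j k l))\<rbrakk> \<Longrightarrow> good A"
  unfolding good_def by blast

lemma good_one: "good (mat 1)"
proof -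
  have "abelianized (mat 1) = ab_upper (of_int (char3 1 0 0 1))" by (simp add: char3_def ab_upper_def upper_0)
  then show ?thesis by (rule goodI[rotated 6]) auto
qed

lemma good_upper:
  assumes "good A" "x \<in> O_d" shows "good (A ** upper x)"
proof -
  obtain i j k l where A: "A \<in> SL" "i * l - j * k = 1" "int_cong (A$1$1) i" "int_cong (A$1$2) j"
     "int_cong (A$2$1) k" "int_cong (A$2$2) l" "abelianized A = ab_upper (of_int (char3 i j k l))"
    using assms(1) unfolding good_def by blast
  obtain m where m: "int_cong x m" using int_cong_exists assms(2) by blast
  then obtain t where t: "t \<in> O_d" "x = of_int m + s * t" by (auto simp: int_cong_def)
  obtain t' where t': "char3 i (m * i + j) k (m * k + l) = char3 i j k l + m + 3 * t'"
    using char3_upper[OF A(2)] by blast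
  have "abelianized (A ** upper x) = ab_upper (of_int (char3 i j k l)) \<otimes>\<^bsub>Q\<^esub> ab_upper x"
    using A assms by (simp add: abelianized_mult ab_upper_def)
  also have "ab_upper x = ab_upper (of_int m)" unfolding t(2) using t(1) by (simp add: ab_upper_cong)
  also have "ab_upper (of_int (char3 i j k l)) \<otimes>\<^bsub>Q\<^esub> ab_upper (of_int m) = ab_upper (of_int (char3 i j k l + m))"
    by (simp add: ab_upper_add)
  also have "\<dots> = ab_upper (of_int (char3 i (m * i + j) k (m * k + l)))" unfolding t' ab_upper_cong_3 ..
  finally have "abelianized (A ** upper x) = \<dots>" .
  moreover have "i * (m * k + l) - (m * i + j) * k = 1" using A(2) by (simp add: algebra_simps)
  moreover have "A ** upper x \<in> SL" using A assms by auto
  ultimately show ?thesis using A m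
    by (intro goodI[of _ i "m * k + l" "m * i + j" k])
      (auto simp: mult_upper intro!: int_cong_add int_cong_mult)
qed

lemma good_S:
  assumes "good A" shows "good (A ** S)"
proof -
  obtain i j k l where A: "A \<in> SL" "i * l - j * k = 1" "int_cong (A$1$1) i" "int_cong (A$1$2) j"
     "int_cong (A$2$1) k" "int_cong (A$2$2) l" "abelianized A = ab_upper (of_int (char3 i j k l))"
    using assms(1) unfolding good_def by blast
  have "abelianized (A ** S) = ab_upper (of_int (char3 i j k l))"
    using A by (simp add: abelianized_mult abelianized_S)
  also have "\<dots> = ab_upper (of_int (char3 j (- i) l (- k)))"
    unfolding char3_S[OF A(2)] ab_upper_cong_3 ..
  finally have "abelianized (A ** S) = \<dots>" .
  moreover have "j * (- k) - (- i) * l = 1" using A(2) by (simp add: algebra_simps)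
  moreover have "A ** S \<in> SL" using A by auto
  ultimately show ?thesis using A
    by (intro goodI[of _ j "- k" "- i" l]) (auto simp: S_mult intro!: int_cong_uminus)
qed

lemma good_upperD: "good (A ** upper x) \<Longrightarrow> x \<in> O_d \<Longrightarrow> good A"
  using good_upper[of "A ** upper x" "- x"]
  by (simp add: mult_upper mat2_eta)

text \<open>\<open>S\<close> has order 4, so three further factors \<open>S\<close> lead back to
  \<open>A\<close>.\<close>

lemma good_SD: "good (A ** S) \<Longrightarrow> good A"
  using good_S[OF good_S[OF good_S[of "A ** S"]]]
  by (simp add: S_mult mat2_eta)

text \<open>The Euclidean algorithm on the bottom row: descent on the norm of the lower left entry,
  with \<open>good\<close> carried back along each step.\<close>

lemma good_all: "A \<in> SL \<Longrightarrow> good A"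
proof -
  have "good A" if "A \<in> SL" "(cmod (A$2$1))\<^sup>2 = real n" for A n
    using that
  proof (induction n arbitrary: A rule: less_induct)
    case (less n)
    obtain a b c e where A: "A = mat2 a b c e" using mat2_eta by metis
    have O: "a \<in> O_d" "b \<in> O_d" "c \<in> O_d" "e \<in> O_d" and det: "a * e - b * c = 1" using less.prems(1) A mat2_SL_iff by auto
    show ?case
    proof (cases "c = 0")
      case True
      have "good (mat 1 ** upper (- a) ** S ** upper (- e))"
        by (intro good_upper good_S good_one O O_uminus)
      \<comment> \<open>The first translation makes \<open>A\<close> diagonal with inverse units
        \<open>a\<close>, \<open>e\<close>; the identity writes such a diagonal matrix as a word in
        translations and \<open>S\<close>.\<close>
      moreover have "mat 1 ** upper (- a) ** S ** upper (- e) = (A ** upper (- e * b) ** S ** upper a) ** S"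
      proof -
        have ae: "a * e = 1" "e * a = 1" using det True by (simp_all add: mult.commute)
        then have "a * (e * b) = b" "a * (b * e) = b" by (simp_all add: mult.left_commute flip: mult.assoc)
        with ae show ?thesis using True by (simp add: A mult_upper S_mult matrix_2_eq_iff)
      qed
      ultimately have "good ((A ** upper (- e * b) ** S ** upper a) ** S)" by simp
      then have "good (A ** upper (- e * b) ** S ** upper a)" by (rule good_SD)
      then have "good (A ** upper (- e * b) ** S)" by (rule good_upperD) (use O in auto)
      then have "good (A ** upper (- e * b))" by (rule good_SD)
      then show ?thesis by (rule good_upperD) (use O in auto)
    next
      case False
      obtain q where q: "q \<in> O_d" "cmod (e - q * c) < cmod c" using euclid[OF O(4,3) False] .
      \<comment> \<open>The translation replaces \<open>e\<close> by its remainder modulo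
        \<open>c\<close>, and \<open>S\<close> moves the remainder to the lower left.\<close>
      let ?B = "A ** upper (- q) ** S"
      have B: "?B $ 2 $ 1 = e - q * c" by (simp add: A mult_upper S_mult)
      obtain m :: nat where m: "(cmod (e - q * c))\<^sup>2 = real m" using O_norm_nat[of "e - q * c"] O q by auto
      have "(cmod (e - q * c))\<^sup>2 < (cmod c)\<^sup>2" using q by (intro power_strict_mono) auto
      then have "m < n" using m less.prems(2) by (simp add: A)
      then have "good ?B" using less.prems(1) q m B by (intro less.IH[of m]) auto
      then have "good (A ** upper (- q))" by (rule good_SD)
      then show ?thesis by (rule good_upperD) (use q in auto)
    qed
  qed
  then show "A \<in> SL \<Longrightarrow> good A" using O_norm_nat SL_iff by meson
qed

text \<open>Each summand of \<open>char3\<close> contains \<open>j\<close> or \<open>k\<close>, so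
  it vanishes modulo 3. Only off-diagonal entries enter, which treats I and -I alike.\<close>

lemma congruence_imp_commutator:
  assumes A: "A \<in> SL" and t: "t \<in> O_d" "t' \<in> O_d" "A$1$2 = s * t" "A$2$1 = s * t'"
  shows "cls A \<in> commutator_subgroup d"
proof -
  obtain i j k l where *: "int_cong (A$1$2) j" "int_cong (A$2$1) k" "abelianized A = ab_upper (of_int (char3 i j k l))"
    using good_all[OF A] unfolding good_def by blast
  have "3 dvd j" "3 dvd k" using * t int_cong_0_imp_dvd by metis+
  then have "3 dvd char3 i j k l" by (auto simp: char3_def)
  then obtain m where "char3 i j k l = 0 + 3 * m" by (auto elim: dvdE)
  then have "abelianized A = ab_upper (of_int 0)" using * ab_upper_cong_3 by metis
  also have "\<dots> = ab_upper (s * 0)" by simp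
  also have "\<dots> = \<one>\<^bsub>Q\<^esub>" by (rule ab_upper_s_mult) simp
  finally show ?thesis by (rule abelianized_eq_one[OF A])
qed

lemma principal_congruence_le_commutator:
  "\<exists>\<pi>. ideal \<pi> (ring_of_integers d) \<and> \<pi> \<noteq> {0} \<and> principal_congruence_subgroup d \<pi> \<subseteq> commutator_subgroup d"
proof (intro exI conjI)
  let ?\<pi> = "PIdl\<^bsub>ring_of_integers d\<^esub> s"
  show "ideal ?\<pi> (ring_of_integers d)"
    by (rule cring.cgenideal_ideal[OF cring_ring_of_integers]) (simp add: carrier_ring_of_integers)
  have \<pi>: "?\<pi> = {t * s | t. t \<in> O_d}"
    unfolding cgenideal_def carrier_ring_of_integers by (simp add: ring_of_integers_def)
  have "s \<in> ?\<pi>" unfolding \<pi> by (auto intro!: exI[of _ 1])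
  then show "?\<pi> \<noteq> {0}" using s_nonzero by (metis singletonD)
  show "principal_congruence_subgroup d ?\<pi> \<subseteq> commutator_subgroup d"
  proof
    fix x assume "x \<in> principal_congruence_subgroup d ?\<pi>"
    then obtain A B where B: "B \<in> SL" "x = cls B" "A \<in> x"
      and A: "matrix_cong ?\<pi> A (mat 1) \<or> matrix_cong ?\<pi> A (- mat 1)"
      unfolding principal_congruence_subgroup_def carrier_bianchi by blast
    have "A = B \<or> A = - B" using B(2,3) by (simp add: cls_eq)
    moreover have "cls (- B) = cls B" by (auto simp: cls_eq)
    ultimately have AB: "A \<in> SL" "x = cls A" using minus_SL[OF B(1)] B(1,2) by metis+
    have "A$1$2 \<in> ?\<pi>" "A$2$1 \<in> ?\<pi>" using A by (auto simp: matrix_cong_def forall_2)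
    then obtain t t' where "t \<in> O_d" "t' \<in> O_d" "A$1$2 = s * t" "A$2$1 = s * t'"
      unfolding \<pi> by (auto simp: mult.commute)
    then show "x \<in> commutator_subgroup d" using congruence_imp_commutator AB by blast
  qed
qed

end

end

theorem proposition6p2:
  fixes d :: int
  assumes "d < 0" and "squarefree d" and "d mod 8 = 5"
  shows "(noncongruence_subgroup d (commutator_subgroup d) \<longleftrightarrow> d \<noteq> -3) \<and>
         (noncongruence_subgroup d (square_subgroup d) \<longleftrightarrow> d \<noteq> -3)"
proof -
  interpret imaginary_quadratic d
    by unfold_locales (use assms in presburger)+
  have sub: "subgroup (commutator_subgroup d) (bianchi_group d)"
    by (rule commutator.subgroup_axioms)
  have sub2: "subgroup (square_subgroup d) (bianchi_group d)"
    unfolding square_subgroup_def by (rule PSL.generate_is_subgroup) auto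
  show ?thesis
  proof (cases "d = -3")
    case True
    then have "congruence_subgroup d (commutator_subgroup d)" "congruence_subgroup d (square_subgroup d)"
      using principal_congruence_le_commutator sub sub2 commutator_subgroup_le_square_subgroup
      unfolding congruence_subgroup_def by blast+
    then show ?thesis using True by (simp add: noncongruence_subgroup_def)
  next
    case False
    \<comment> \<open>The residue 5 modulo 8 leaves d <= -11.\<close>
    then have d: "d < -4" using assms(1,3) by presburger
    have "\<not> congruence_subgroup d (square_subgroup d)"
      unfolding congruence_subgroup_def
      using no_congruence_in_even_classes[OF d assms(3)] square_subgroup_even[OF d] by blast
    \<comment> \<open>A congruence subgroup inside the square subgroup would make the latter
      congruence too.\<close>
    moreover from this have "\<not> congruence_subgroup d (commutator_subgroup d)"
      unfolding congruence_subgroup_def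
      using commutator_subgroup_le_square_subgroup sub2 by blast
    ultimately show ?thesis using False sub sub2 by (simp add: noncongruence_subgroup_def)
  qed
qed

end
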